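(* (a) Let $n\in\mathbb{N}$ with $n\geq 4$, and let $\langle A\mid R\rangle$ be any monoid presentation for the symmetric group $S_n$, with associated surjective homomorphism $\pi:A^*\to S_n$ (so that $\ker\pi=R^{\sharp}$). Let $\eta\notin A$ be a new letter. Then the symmetric inverse monoid $I_n$ is defined by the monoid presentation with generators $A\cup\{\eta\}$ and relations $R$ together with the following $3$ relations: $$(2,3)\,\eta=\eta\,(2,3),$$ $$(2,3,\ldots,n)\,\eta=\eta^2\,(2,3,\ldots,n),$$ $$(1,2)\,\eta\,(1,2)\,\eta\,(1,2)\,\eta\,(1,2)=\eta\,(1,2)\,\eta,$$ where $(2,3)$, $(2,3,\ldots,n)$ and $(1,2)$ denote any words in $A^*$ representing these permutations under $\pi$, and the letter $\eta$ represents the idempotent of rank $n-1$ in $I_n$ with $1\notin\operatorname{dom}(\eta)$ (i.e. the identity map on $\{2,\ldots,n\}$). (b) Furthermore, every monoid presentation for $I_n$, $n\geq 3$, requires at least $3$ non-$S_n$ relations; that is, if $n\geq 3$ and $\langle A,B\mid R,S\rangle$ is a monoid presentation for $I_n$, where $\langle A\mid R\rangle$ is a monoid presentation for the symmetric group $S_n\leq I_n$, then $|S|\geq 3$.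
   Context: Maps act on the right and are composed from left to right: $(x)(fg)=((x)f)g$. $I_n$ is the monoid of all partial permutations (injective partial maps $\{1,\ldots,n\}\to\{1,\ldots,n\}$) under composition; the rank of an element is the size of its image. Its group of units is $S_n$. Permutations are written in disjoint cycle notation. A (monoid) presentation is a pair $\langle X\mid Q\rangle$ with $X$ an alphabet and $Q\subseteq X^*\times X^*$; only finite presentations are considered. It defines the quotient $X^*/Q^{\sharp}$, where $Q^{\sharp}$ is the least congruence on the free monoid $X^*$ containing $Q$. Saying that a monoid $M$ is defined by $\langle X\mid Q\rangle$, where each letter represents a specified element of $M$, means that the homomorphism $X^*\to M$ sending each letter to the element it represents is surjective with kernel $Q^{\sharp}$. In (a), each letter of $A$ represents its image under $\pi$. The notation $\langle A,B\mid R,S\rangle$ means $\langle A\cup B\mid R\cup S\rangle$, with $A\cap B=\varnothing$ and $R\subseteq A^*\times A^*$. In (b), if $\phi:(A\cup B)^*\to I_n$ is the surjective homomorphism associated to the presentation of $I_n$, then "$\langle A\mid R\rangle$ is a monoid presentation for $S_n\leq I_n$" means that the restriction of $\phi$ to $A^*$ has image $S_n$ and kernel equal to the congruence on $A^*$ generated by $R$. The relations in $S$ are called the non-$S_n$ relations. *)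

theory Defs
  imports "HOL-Algebra.Group" "HOL-Combinatorics.Cycles"
begin

section \<open>Monoid presentations\<close>

text \<open>
  The free monoid on an alphabet \<open>X\<close> is \<open>lists X\<close> under concatenation.
\<close>

definition word_congruence :: "'a set \<Rightarrow> ('a list \<times> 'a list) set \<Rightarrow> bool" where
  "word_congruence X r \<longleftrightarrow>
     equiv (lists X) r \<and>
     (\<forall>(u, v)\<in>r. \<forall>(u', v')\<in>r. (u @ u', v @ v') \<in> r)"

definition generated_congruence ::
    "'a set \<Rightarrow> ('a list \<times> 'a list) set \<Rightarrow> ('a list \<times> 'a list) set" where
  "generated_congruence X Q = \<Inter>{r. word_congruence X r \<and> Q \<subseteq> r}"

text \<open>
  The unique monoid homomorphism from \<open>lists X\<close> to \<open>M\<close> that extends the assignment \<open>g\<close> of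
  letters to elements of \<open>M\<close>.
\<close>

definition word_value :: "('m, 'c) monoid_scheme \<Rightarrow> ('a \<Rightarrow> 'm) \<Rightarrow> 'a list \<Rightarrow> 'm" where
  "word_value M g w = foldr (\<lambda>a m. g a \<otimes>\<^bsub>M\<^esub> m) w \<one>\<^bsub>M\<^esub>"

definition word_kernel ::
    "'a set \<Rightarrow> ('m, 'c) monoid_scheme \<Rightarrow> ('a \<Rightarrow> 'm) \<Rightarrow> ('a list \<times> 'a list) set" where
  "word_kernel X M g =
     {(u, v). u \<in> lists X \<and> v \<in> lists X \<and> word_value M g u = word_value M g v}"

text \<open>
  \<open>M\<close> is defined by the finite presentation \<open>\<langle>X | Q\<rangle>\<close>, the letter \<open>a\<close> representing \<open>g a\<close>.
\<close>

definition monoid_presentation ::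
    "'a set \<Rightarrow> ('a list \<times> 'a list) set \<Rightarrow> ('m, 'c) monoid_scheme \<Rightarrow> ('a \<Rightarrow> 'm) \<Rightarrow> bool" where
  "monoid_presentation X Q M g \<longleftrightarrow>
     finite X \<and> finite Q \<and> Q \<subseteq> lists X \<times> lists X \<and>
     g \<in> X \<rightarrow> carrier M \<and>
     word_value M g ` lists X = carrier M \<and>
     word_kernel X M g = generated_congruence X Q"

lemma word_value_Nil: "word_value M g [] = \<one>\<^bsub>M\<^esub>"
  by (simp add: word_value_def)

lemma (in monoid) word_value_closed:
  "g \<in> X \<rightarrow> carrier G \<Longrightarrow> w \<in> lists X \<Longrightarrow> word_value G g w \<in> carrier G"
  by (induction w) (auto simp: word_value_def)

lemma (in monoid) word_value_singleton:
  "g a \<in> carrier G \<Longrightarrow> word_value G g [a] = g a"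
  by (simp add: word_value_def)

lemma (in monoid) word_value_append:
  assumes "g \<in> X \<rightarrow> carrier G" "u \<in> lists X" "v \<in> lists X"
  shows "word_value G g (u @ v) = word_value G g u \<otimes> word_value G g v"
  using assms(2)
proof (induction u)
  case Nil
  then show ?case
    using word_value_closed[OF assms(1,3)] by (simp add: word_value_def)
next
  case (Cons a u)
  then have "g a \<in> carrier G" "u \<in> lists X" using assms(1) by auto
  with Cons word_value_closed[OF assms(1)] assms(3) show ?case
    by (simp add: word_value_def m_assoc)
qed

section \<open>Symmetric inverse monoids and symmetric groups\<close>

text \<open>
  A partial map of \<open>{1..n}\<close> is a function \<open>nat \<rightharpoonup> nat\<close> that is undefined outside \<open>{1..n}\<close>. Maps act
  on the right, so the product \<open>f g\<close> means first \<open>f\<close>, then \<open>g\<close>.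
\<close>

definition sym_inv_monoid :: "nat \<Rightarrow> (nat \<rightharpoonup> nat) monoid" where
  "sym_inv_monoid n =
     \<lparr> carrier = {f. dom f \<subseteq> {1..n} \<and> ran f \<subseteq> {1..n} \<and> inj_on f (dom f)},
       monoid.mult = (\<lambda>f g. g \<circ>\<^sub>m f),
       one = Some |` {1..n} \<rparr>"

definition perm_map :: "nat \<Rightarrow> (nat \<Rightarrow> nat) \<Rightarrow> (nat \<rightharpoonup> nat)" where
  "perm_map n p = (\<lambda>x. Some (p x)) |` {1..n}"

text \<open>
  The symmetric group as a submonoid of \<open>sym_inv_monoid n\<close>. The library's \<open>sym_group n\<close> composes
  from right to left and consists of total functions on \<open>nat\<close>, so it is not used here.
\<close>

definition sym_submonoid :: "nat \<Rightarrow> (nat \<rightharpoonup> nat) monoid" where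
  "sym_submonoid n = (sym_inv_monoid n)\<lparr> carrier := perm_map n ` {p. p permutes {1..n}} \<rparr>"

text \<open>The permutation written \<open>(c\<^sub>1, \<dots>, c\<^sub>k)\<close> in cycle notation, as an element of \<open>sym_submonoid n\<close>.\<close>

definition cycle_map :: "nat \<Rightarrow> nat list \<Rightarrow> (nat \<rightharpoonup> nat)" where
  "cycle_map n cs = perm_map n (cycle_of_list cs)"

lemma monoid_sym_inv_monoid: "monoid (sym_inv_monoid n)"
proof (rule monoidI)
  fix f g assume fg: "f \<in> carrier (sym_inv_monoid n)" "g \<in> carrier (sym_inv_monoid n)"
  have "inj_on (g \<circ>\<^sub>m f) (dom (g \<circ>\<^sub>m f))"
  proof (rule inj_onI)
    fix x y assume xy: "x \<in> dom (g \<circ>\<^sub>m f)" "y \<in> dom (g \<circ>\<^sub>m f)" "(g \<circ>\<^sub>m f) x = (g \<circ>\<^sub>m f) y"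
    then obtain a b z where "f x = Some a" "f y = Some b" "g a = Some z" "g b = Some z"
      by (auto simp: map_comp_Some_iff)
    with fg show "x = y"
      unfolding sym_inv_monoid_def by (auto simp: inj_on_def dom_def)
  qed
  with fg show "f \<otimes>\<^bsub>sym_inv_monoid n\<^esub> g \<in> carrier (sym_inv_monoid n)"
    unfolding sym_inv_monoid_def
    by (auto simp: map_comp_Some_iff ran_def dom_def subset_iff)
next
  show "\<one>\<^bsub>sym_inv_monoid n\<^esub> \<in> carrier (sym_inv_monoid n)"
    by (auto simp: sym_inv_monoid_def ran_def restrict_map_def inj_on_def split: if_splits)
next
  fix f g h :: "nat \<rightharpoonup> nat"
  show "f \<otimes>\<^bsub>sym_inv_monoid n\<^esub> g \<otimes>\<^bsub>sym_inv_monoid n\<^esub> h =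
        f \<otimes>\<^bsub>sym_inv_monoid n\<^esub> (g \<otimes>\<^bsub>sym_inv_monoid n\<^esub> h)"
    by (auto simp: sym_inv_monoid_def map_comp_def split: option.splits)
next
  fix f assume "f \<in> carrier (sym_inv_monoid n)"
  then show "\<one>\<^bsub>sym_inv_monoid n\<^esub> \<otimes>\<^bsub>sym_inv_monoid n\<^esub> f = f"
    by (auto simp: sym_inv_monoid_def map_comp_def restrict_map_def fun_eq_iff dom_def subset_iff)
       (metis option.exhaust)+
next
  fix f assume "f \<in> carrier (sym_inv_monoid n)"
  then show "f \<otimes>\<^bsub>sym_inv_monoid n\<^esub> \<one>\<^bsub>sym_inv_monoid n\<^esub> = f"
    by (auto simp: sym_inv_monoid_def map_comp_def restrict_map_def fun_eq_iff ran_def subset_iff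
             split: option.splits)
qed

lemma perm_map_in_carrier:
  assumes "p permutes {1..n}"
  shows "perm_map n p \<in> carrier (sym_inv_monoid n)"
proof -
  have "p x \<in> {1..n}" if "x \<in> {1..n}" for x
    using permutes_in_image[OF assms] that by blast
  moreover have "x = y" if "p x = p y" for x y
    using permutes_inj[OF assms] that by (auto dest: injD)
  ultimately show ?thesis
    by (auto simp: perm_map_def sym_inv_monoid_def inj_on_def ran_def restrict_map_def
             split: if_splits)
qed

lemma perm_map_mult:
  assumes "p permutes {1..n}"
  shows "perm_map n p \<otimes>\<^bsub>sym_inv_monoid n\<^esub> perm_map n q = perm_map n (q \<circ> p)"
proof
  fix x
  have "p x \<in> {1..n} \<longleftrightarrow> x \<in> {1..n}"
    using permutes_in_image[OF assms] .
  then show "(perm_map n p \<otimes>\<^bsub>sym_inv_monoid n\<^esub> perm_map n q) x = perm_map n (q \<circ> p) x"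
    by (auto simp: perm_map_def sym_inv_monoid_def map_comp_def restrict_map_def)
qed

lemma carrier_sym_submonoid: "carrier (sym_submonoid n) = Units (sym_inv_monoid n)"
proof (intro equalityI subsetI)
  fix f assume "f \<in> carrier (sym_submonoid n)"
  then obtain p where p: "p permutes {1..n}" "f = perm_map n p"
    by (auto simp: sym_submonoid_def)
  define q where "q = inv_into UNIV p"
  have q: "q permutes {1..n}" "q \<circ> p = id" "p \<circ> q = id"
    using permutes_inv[OF p(1)] permutes_inv_o[OF p(1)] by (auto simp: q_def)
  have one: "perm_map n id = \<one>\<^bsub>sym_inv_monoid n\<^esub>"
    by (simp add: perm_map_def sym_inv_monoid_def fun_eq_iff restrict_map_def)
  have "f \<otimes>\<^bsub>sym_inv_monoid n\<^esub> perm_map n q = \<one>\<^bsub>sym_inv_monoid n\<^esub>"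
       "perm_map n q \<otimes>\<^bsub>sym_inv_monoid n\<^esub> f = \<one>\<^bsub>sym_inv_monoid n\<^esub>"
    using perm_map_mult[OF p(1)] perm_map_mult[OF q(1)] p(2) q(2,3) one by simp_all
  then show "f \<in> Units (sym_inv_monoid n)"
    using perm_map_in_carrier[OF p(1)] perm_map_in_carrier[OF q(1)] p(2)
    unfolding Units_def by blast
next
  fix f assume "f \<in> Units (sym_inv_monoid n)"
  then obtain g where f: "dom f \<subseteq> {1..n}" "ran f \<subseteq> {1..n}" "inj_on f (dom f)"
    and gf: "g \<circ>\<^sub>m f = Some |` {1..n}"
    by (auto simp: Units_def sym_inv_monoid_def)
  have dom: "dom f = {1..n}"
  proof -
    have "x \<in> dom f" if "x \<in> {1..n}" for x
      using fun_cong[OF gf, of x] that by (auto simp: map_comp_def split: option.splits)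
    with f(1) show ?thesis by blast
  qed
  define p where "p x = (if x \<in> {1..n} then the (f x) else x)" for x
  have fp: "f x = Some (p x)" if "x \<in> {1..n}" for x
  proof -
    have "x \<in> dom f" using that dom by simp
    then show ?thesis using that by (auto simp: p_def)
  qed
  have "inj_on p {1..n}"
    using f(3) unfolding dom inj_on_def by (metis fp)
  moreover have "p ` {1..n} \<subseteq> {1..n}"
  proof
    fix y assume "y \<in> p ` {1..n}"
    then obtain x where "x \<in> {1..n}" "y = p x" by blast
    then show "y \<in> {1..n}" using f(2) ranI[of f x y] fp[of x] by blast
  qed
  ultimately have "bij_betw p {1..n} {1..n}"
    by (simp add: bij_betw_def endo_inj_surj)
  then have "p permutes {1..n}"
    by (rule bij_imp_permutes) (auto simp: p_def)
  moreover have "f = perm_map n p"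
  proof
    fix x
    show "f x = perm_map n p x"
    proof (cases "x \<in> {1..n}")
      case True
      then show ?thesis by (simp only: perm_map_def restrict_in fp)
    next
      case False
      then have "f x = None" using dom by blast
      then show ?thesis by (simp only: perm_map_def restrict_out[OF False])
    qed
  qed
  ultimately show "f \<in> carrier (sym_submonoid n)"
    by (auto simp: sym_submonoid_def)
qed

end

theory Submission
  imports Defs
begin

text \<open>
  (a) The cycle \<open>c = (2, \<dots>, n)\<close> carries \<open>(i, i+1)\<close> to \<open>(i+1, i+2)\<close> under conjugation and satisfies
  \<open>c \<eta> = \<eta>\<^sup>2 c\<close>; since \<open>(2, 3)\<close> commutes with \<open>\<eta>\<close>, so do all adjacent transpositions of
  \<open>{2, \<dots>, n}\<close>, hence \<open>c\<close>, and \<open>\<eta>\<^sup>2 = \<eta>\<close> follows. For \<open>e = \<eta>\<close>, \<open>s = (1, 2)\<close> and \<open>f = s e s\<close> the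
  third relation reads \<open>f e f = e s e\<close>, which forces \<open>e f = f e = e f s\<close>. The conjugates \<open>e\<^sub>i\<close> of \<open>\<eta>\<close>
  therefore commute, and each word equals \<open>e\<^sub>D p\<close> with \<open>p\<close> a permutation, of which only the
  restriction to the complement of \<open>D\<close> matters.

  (b) At least one relation has rank \<open>n - 2\<close>: relations of higher rank preserve the domain of the
  longest prefix of rank at least \<open>n - 1\<close>, which separates \<open>e\<^sub>1 e\<^sub>2\<close> from \<open>e\<^sub>2 e\<^sub>1\<close>. At least two have
  rank \<open>n - 1\<close>. If there were only one, \<open>u = v\<close>, then counting letters of rank below \<open>n\<close> modulo
  the difference of their numbers in \<open>u\<close> and \<open>v\<close> shows that this difference is 1, and the words
  with a single such letter \<open>b\<close> show that \<open>u = x b y\<close> and \<open>v = x' b m b y'\<close>. The signs of \<open>x, x'\<close>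
  differ, as do those of \<open>y, y'\<close>, because otherwise the sign to the left (right) of the first (last)
  \<open>b\<close> would be an invariant. But then a homomorphism to \<open>S\<^sub>3\<close> sending \<open>b\<close> to \<open>i \<mapsto> sgn(m) i + 1\<close>
  modulo 3 and permutations to their signs respects \<open>u = v\<close> and contradicts \<open>t b = b t'\<close> for suitable
  transpositions \<open>t, t'\<close>.
\<close>

section \<open>Consequences of the three relations\<close>

declare One_nat_def [simp del]

section \<open>Cycles on intervals of points\<close>

lemma comp_transpose: "inj f \<Longrightarrow> f \<circ> transpose a b = transpose (f a) (f b) \<circ> f"
  by (auto simp: fun_eq_iff transpose_def dest: injD)

lemma cycle_of_list_upt:
  assumes "a \<le> i" "Suc i < b"
  shows "cycle_of_list [a..<b] i = Suc i"
  using assms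
proof (induction "i - a" arbitrary: a)
  case 0
  then have "cycle_of_list [a..<b] i = transpose a (Suc a) (cycle_of_list [Suc a..<b] a)"
    by (simp add: upt_conv_Cons)
  moreover have "cycle_of_list [Suc a..<b] a = a" by (rule id_outside_supp) simp
  ultimately show ?case using 0 by simp
next
  case (Suc m)
  then have "cycle_of_list [Suc a..<b] i = Suc i" by simp
  moreover from Suc
  have "cycle_of_list [a..<b] i = transpose a (Suc a) (cycle_of_list [Suc a..<b] i)"
    by (simp add: upt_conv_Cons)
  moreover have "a < i" using Suc.hyps(2) by simp
  ultimately show ?case by (simp add: transpose_def)
qed

text \<open>\<open>cycle_of_list\<close> peels off one adjacent transposition at a time, starting at
  the left end of the interval. This carries commutation with \<eta> from adjacent transpositions
  over to the cycle (2, ..., n).\<close>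

lemma cycle_of_list_adjacent_induct:
  assumes "Q id"
    and "\<And>i p. a \<le> i \<Longrightarrow> Suc i < b \<Longrightarrow> p permutes {a..<b} \<Longrightarrow> Q p \<Longrightarrow> Q (transpose i (Suc i) \<circ> p)"
  shows "Q (cycle_of_list [a..<b])"
  using assms(2)
proof (induction "b - a" arbitrary: a)
  case 0
  then have "[a..<b] = []" by simp
  then show ?case using assms(1) by (simp only: cycle_of_list.simps)
next
  case (Suc m)
  show ?case
  proof (cases "Suc a < b")
    case True
    have "Q (cycle_of_list [Suc a..<b])"
    proof (rule Suc.hyps(1))
      show "m = b - Suc a" using Suc.hyps(2) by simp
      fix i p assume "Suc a \<le> i" "Suc i < b" "p permutes {Suc a..<b}" "Q p"
      moreover from this have "p permutes {a..<b}" by (auto intro: permutes_subset)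
      ultimately show "Q (transpose i (Suc i) \<circ> p)" using Suc.prems by simp
    qed
    moreover have "cycle_of_list [Suc a..<b] permutes {a..<b}"
      using cycle_permutes[of "[Suc a..<b]"] by (auto intro: permutes_subset)
    moreover have "cycle_of_list [a..<b] = transpose a (Suc a) \<circ> cycle_of_list [Suc a..<b]"
      using True by (simp add: upt_conv_Cons)
    ultimately show ?thesis using Suc.prems True by simp
  next
    case False
    then have "[a..<b] = [a]" using Suc.hyps(2) by (simp add: upt_conv_Cons)
    then show ?thesis using assms(1) by (simp only: cycle_of_list.simps)
  qed
qed

text \<open>An arbitrary monoid in which the relations hold, seen through the values
  \<open>P p\<close> of permutations and \<open>h\<close> of \<eta>. \<open>P\<close> reverses the
  order of \<open>\<circ>\<close> because maps act on the right.\<close>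

locale sym_inv_relations =
  fixes n :: nat and P :: "(nat \<Rightarrow> nat) \<Rightarrow> 'm::monoid_mult" and h :: 'm
  assumes n: "3 \<le> n"
    and P_id: "P id = 1"
    and P_comp: "p permutes {1..n} \<Longrightarrow> q permutes {1..n} \<Longrightarrow> P (q \<circ> p) = P p * P q"
    and rel_transpose: "P (transpose 2 3) * h = h * P (transpose 2 3)"
    and rel_cycle: "P (cycle_of_list [2..<Suc n]) * h = h * h * P (cycle_of_list [2..<Suc n])"
    and rel_swap: "P (transpose 1 2) * h * P (transpose 1 2) * h * P (transpose 1 2) * h
          * P (transpose 1 2) = h * P (transpose 1 2) * h"
begin

lemma transpose_permutes: "i \<in> {1..n} \<Longrightarrow> j \<in> {1..n} \<Longrightarrow> transpose i j permutes {1..n}"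
  by (rule permutes_swap_id)

lemma P_inv:
  assumes "p permutes {1..n}"
  shows "P (Hilbert_Choice.inv p) * P p = 1" "P p * P (Hilbert_Choice.inv p) = 1"
  using P_comp[OF assms permutes_inv[OF assms]] P_comp[OF permutes_inv[OF assms] assms]
    permutes_inv_o[OF assms] by (simp_all add: P_id)

lemma P_left_cancel:
  assumes "p permutes {1..n}" "P p * x = P p * y"
  shows "x = y"
  using P_inv(1)[OF assms(1)] assms(2) by (metis mult.assoc mult_1_left)

lemma P_right_cancel:
  assumes "p permutes {1..n}" "x * P p = y * P p"
  shows "x = y"
  using P_inv(2)[OF assms(1)] assms(2) by (metis mult.assoc mult_1_right)

section \<open>Permutations that commute with \<eta>\<close>

definition commutes :: "(nat \<Rightarrow> nat) \<Rightarrow> bool" where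
  "commutes p \<longleftrightarrow> P p * h = h * P p"

lemma commutes_comp:
  assumes "p permutes {1..n}" "q permutes {1..n}" "commutes p" "commutes q"
  shows "commutes (q \<circ> p)"
  using assms unfolding commutes_def by (metis P_comp mult.assoc)

text \<open>
  The cycle \<open>c\<close> conjugates \<open>(i, i+1)\<close> to \<open>(i+1, i+2)\<close> and \<open>\<eta>\<close> to \<open>\<eta>\<^sup>2\<close>, so commuting with \<open>\<eta>\<close> passes
  from each adjacent transposition to the next.
\<close>

lemma commutes_adjacent:
  assumes "2 \<le> i" "Suc i \<le> n"
  shows "commutes (transpose i (Suc i))"
  using assms
proof (induction i rule: dec_induct)
  case base
  then show ?case using rel_transpose by (simp add: commutes_def numeral_3_eq_3 numeral_2_eq_2)
next
  case (step i)
  define c where "c = cycle_of_list [2..<Suc n]"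
  define t where "t = transpose i (Suc i)"
  define t' where "t' = transpose (Suc i) (Suc (Suc i))"
  have c: "c permutes {1..n}"
    unfolding c_def using cycle_permutes[of "[2..<Suc n]"] by (auto intro: permutes_subset)
  have t: "t permutes {1..n}" "t' permutes {1..n}"
    unfolding t_def t'_def using step.hyps step.prems by (intro transpose_permutes; simp)+
  have "c i = Suc i" "c (Suc i) = Suc (Suc i)"
    unfolding c_def using step by (simp_all add: cycle_of_list_upt del: upt_Suc)
  then have "c \<circ> t = t' \<circ> c"
    unfolding t_def t'_def by (simp add: comp_transpose permutes_inj[OF c])
  then have ct: "P c * P t' = P t * P c"
    using P_comp c t by metis
  have th: "P t * h = h * P t"
    using step.IH step.prems by (simp add: commutes_def t_def)
  have ch: "P c * h = h * h * P c"
    using rel_cycle by (simp add: c_def)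
  have "P c * (P t' * h) = P t * (P c * h)" by (simp add: ct flip: mult.assoc)
  also have "\<dots> = (P t * h) * h * P c" by (simp add: ch mult.assoc)
  also have "\<dots> = h * (P t * h) * P c" by (simp add: th mult.assoc)
  also have "\<dots> = h * h * (P t * P c)" by (simp add: th mult.assoc)
  also have "\<dots> = (h * h * P c) * P t'" by (simp add: ct mult.assoc)
  also have "\<dots> = (P c * h) * P t'" by (simp only: ch)
  finally show ?case
    using P_left_cancel[OF c] by (simp add: commutes_def t'_def mult.assoc)
qed

lemma commutes_cycle: "commutes (cycle_of_list [2..<Suc n])"
proof (rule cycle_of_list_adjacent_induct)
  show "commutes id" by (simp only: commutes_def P_id mult_1_left mult_1_right)
  fix i p assume "2 \<le> i" "Suc i < Suc n" "p permutes {2..<Suc n}" "commutes p"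
  moreover from this have "p permutes {1..n}" by (auto intro: permutes_subset)
  ultimately show "commutes (transpose i (Suc i) \<circ> p)"
    by (intro commutes_comp commutes_adjacent transpose_permutes) auto
qed

lemma h_idem: "h * h = h"
proof -
  have c: "cycle_of_list [2..<Suc n] permutes {1..n}"
    using cycle_permutes[of "[2..<Suc n]"] by (auto intro: permutes_subset)
  show ?thesis
    using rel_cycle commutes_cycle P_right_cancel[OF c, of "h * h" h] by (simp add: commutes_def)
qed

lemma commutes_transpose:
  assumes "2 \<le> i" "i < j" "j \<le> n"
  shows "commutes (transpose i j)"
proof -
  have "Suc i \<le> j" using assms by simp
  then show ?thesis using assms(3)
  proof (induction j rule: dec_induct)
    case base
    then show ?case using assms by (intro commutes_adjacent) auto
  next
    case (step j)
    have "transpose i (Suc j)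
        = transpose j (Suc j) \<circ> (transpose i j \<circ> transpose j (Suc j))"
      using step by (auto simp: fun_eq_iff transpose_def)
    moreover have "commutes (transpose j (Suc j))"
      using step assms by (intro commutes_adjacent) auto
    moreover have "transpose i j permutes {1..n}" "transpose j (Suc j) permutes {1..n}"
      using step.hyps step.prems assms(1) by (intro transpose_permutes; simp)+
    moreover have "commutes (transpose i j)" using step.IH step.prems by simp
    ultimately show ?case by (metis commutes_comp permutes_compose)
  qed
qed

text \<open>The stabilizer of 1 is the symmetric group on {2, ..., n}, which is generated by the
  transpositions of \<open>commutes_transpose\<close>.\<close>

lemma commutes_stabilizer:
  assumes "p permutes {1..n}" "p 1 = 1"
  shows "commutes p"
proof -
  have "p permutes {2..n}"
  proof (rule permutes_superset[OF assms(1)])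
    fix x assume "x \<in> {1..n} - {2..n}"
    then have "x = 1" by auto
    then show "p x = x" using assms(2) by simp
  qed
  from this finite_atLeastAtMost show ?thesis
  proof (induction p rule: permutes_induct)
    case id
    show ?case by (simp only: commutes_def P_id mult_1_left mult_1_right)
  next
    case (swap a b p)
    then have "commutes (transpose a b)"
      using commutes_transpose[of a b] commutes_transpose[of b a]
      by (cases "a < b") (auto simp: transpose_commute)
    moreover have "p permutes {1..n}" using swap by (auto intro: permutes_subset)
    moreover have "transpose a b permutes {1..n}" using swap.hyps by (intro transpose_permutes) auto
    ultimately show ?case using swap.IH by (intro commutes_comp)
  qed
qed

section \<open>Conjugates of \<eta>, standing for the idempotents that are undefined at a single
  point\<close>

definition E :: "nat \<Rightarrow> 'm" where
  "E i = P (transpose 1 i) * h * P (transpose 1 i)"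

lemma E_1: "E 1 = h"
  by (simp add: E_def P_id)

lemma P_transpose_square:
  assumes "i \<in> {1..n}" "j \<in> {1..n}"
  shows "P (transpose i j) * P (transpose i j) = 1"
  using P_comp[OF transpose_permutes[OF assms] transpose_permutes[OF assms]] by (simp add: P_id)

text \<open>Moving 1 to \<open>i\<close>, applying \<open>p\<close> and moving \<open>p i\<close>
  back to 1 gives a permutation \<open>q\<close> that fixes 1. By
  \<open>commutes_stabilizer\<close>, \<open>q\<close> commutes with \<eta>, and unfolding
  \<open>q\<close> gives the claim.\<close>

lemma E_P:
  assumes "i \<in> {1..n}" "p permutes {1..n}"
  shows "E i * P p = P p * E (p i)"
proof -
  define a where "a = transpose 1 i"
  define b where "b = transpose 1 (p i)"
  have "p i \<in> {1..n}" using assms(1) permutes_in_image[OF assms(2)] by blast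
  moreover have "1 \<in> {1..n}" using n by simp
  ultimately have a: "a permutes {1..n}" and b: "b permutes {1..n}"
    and aa: "P a * P a = 1" and bb: "P b * P b = 1"
    unfolding a_def b_def using assms(1)
    by (blast intro: transpose_permutes P_transpose_square)+
  define q where "q = b \<circ> (p \<circ> a)"
  have q: "q permutes {1..n}"
    unfolding q_def using a b assms by (intro permutes_compose)
  have "q 1 = 1" by (simp add: q_def a_def b_def)
  then have comm: "P q * h = h * P q" using commutes_stabilizer q by (simp add: commutes_def)
  have Pq: "P q = P a * P p * P b"
    unfolding q_def using P_comp[OF permutes_compose[OF a assms(2)] b] P_comp[OF a assms(2)]
    by simp
  have "E i * P p = P a * h * P a * P p * (P b * P b)" by (simp only: E_def a_def bb mult_1_right)
  also have "\<dots> = P a * (h * P q) * P b" by (simp add: Pq mult.assoc)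
  also have "\<dots> = P a * P q * h * P b" by (simp only: mult.assoc flip: comm)
  also have "\<dots> = (P a * P a) * P p * (P b * h * P b)" by (simp add: Pq mult.assoc)
  also have "\<dots> = P p * E (p i)" by (simp only: aa E_def b_def mult_1_left)
  finally show ?thesis .
qed

lemma E_idem:
  assumes "i \<in> {1..n}"
  shows "E i * E i = E i"
proof -
  have "E i * E i = P (transpose 1 i) * h * (P (transpose 1 i) * P (transpose 1 i)) * h
      * P (transpose 1 i)"
    by (simp add: E_def mult.assoc)
  also have "P (transpose 1 i) * P (transpose 1 i) = 1"
    using assms n by (intro P_transpose_square) auto
  also have "P (transpose 1 i) * h * 1 * h * P (transpose 1 i)
      = P (transpose 1 i) * (h * h) * P (transpose 1 i)"
    by (simp add: mult.assoc)
  finally show ?thesis by (simp add: h_idem E_def)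
qed

text \<open>Conjugation by \<open>s\<close> exchanges \<open>e\<close> and \<open>f\<close>, and
  \<open>rel_swap\<close> turns into \<open>f * e * f = e * s * e\<close>. So \<open>x\<close>
  equals both \<open>e * f * s\<close> and \<open>s * f * e\<close>. From \<open>x = f * x\<close>
  follows \<open>x = x * s\<close>, and from \<open>x = x * f\<close> follows
  \<open>x = s * x\<close>; cancelling \<open>s\<close> then makes \<open>e * f\<close> and
  \<open>f * e\<close> both equal to \<open>x\<close>.\<close>

lemma E_1_2:
  shows "E 1 * E 2 = E 2 * E 1" and "E 1 * E 2 * P (transpose 1 2) = E 1 * E 2"
proof -
  define s where "s = P (transpose 1 2)"
  define e where "e = E 1"
  define f where "f = E 2"
  have tr: "transpose 1 2 permutes {1..n}" using n by (intro transpose_permutes) auto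
  have ss: "s * s = 1" unfolding s_def using n by (intro P_transpose_square) auto
  have ee: "e * e = e" and ff: "f * f = f"
    unfolding e_def f_def using n E_idem by auto
  have es: "e * s = s * f" and fs: "f * s = s * e"
    unfolding e_def f_def s_def using n E_P[OF _ tr, of 1] E_P[OF _ tr, of 2] by auto
  have es': "e * (s * y) = s * (f * y)" and fs': "f * (s * y) = s * (e * y)" for y
    using es fs by (metis mult.assoc)+
  define x where "x = f * e * f"
  have x: "x = e * s * e"
  proof -
    have "f = s * e * s" by (simp only: f_def e_def E_1) (simp add: E_def s_def)
    then have "x = s * e * s * e * s * e * s" by (simp add: x_def mult.assoc)
    also have "\<dots> = e * s * e" using rel_swap by (simp add: s_def e_def E_1)
    finally show ?thesis .
  qed
  have x1: "x = e * f * s" and x2: "x = s * f * e"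
    by (simp_all add: x mult.assoc fs) (simp_all add: es flip: mult.assoc)
  have "x = f * x" by (simp add: x_def ff flip: mult.assoc)
  also have "\<dots> = f * (s * f * e)" by (simp only: x2)
  also have "\<dots> = s * (e * f * e)" by (simp add: fs flip: mult.assoc)
  also have "\<dots> = f * e * f * s" by (simp add: es fs es' fs' mult.assoc)
  finally have xs: "x = x * s" by (simp add: x_def)
  have "x = x * f" by (simp add: x_def ff mult.assoc)
  also have "\<dots> = (s * f * e) * f" by (simp only: x2)
  also have "\<dots> = s * x" by (simp add: x_def mult.assoc)
  finally have sx: "x = s * x" .
  have "e * f = x * s" by (simp add: x1 ss mult.assoc)
  then have ef: "e * f = x" using xs by simp
  have "f * e = s * x" by (simp add: x2 ss flip: mult.assoc)
  then have fe: "f * e = x" using sx by simp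
  show "E 1 * E 2 = E 2 * E 1" using ef fe by (simp add: e_def f_def)
  show "E 1 * E 2 * P (transpose 1 2) = E 1 * E 2" using ef xs by (simp add: e_def f_def s_def)
qed

text \<open>Both facts are carried over from the points 1 and 2 by a permutation that maps 1 to
  \<open>i\<close> and 2 to \<open>j\<close>.\<close>

lemma E_pair:
  assumes "i \<in> {1..n}" "j \<in> {1..n}" "i \<noteq> j"
  shows "E i * E j = E j * E i" and "E i * E j * P (transpose i j) = E i * E j"
proof -
  \<comment> \<open>\<open>k\<close> is the point to which the first transposition moves 2. It
    differs from \<open>i\<close>, so the second transposition takes it to \<open>j\<close> and
    leaves \<open>i\<close> in place.\<close>
  define k where "k = transpose 1 i (2::nat)"
  define p where "p = transpose k j \<circ> transpose 1 i"
  have k: "k \<in> {1..n}" "k \<noteq> i" using assms n by (auto simp: k_def transpose_def)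
  have p: "p permutes {1..n}"
    unfolding p_def using assms k n by (intro permutes_compose transpose_permutes) auto
  have p12: "p 1 = i" "p 2 = j"
    using assms k by (auto simp: p_def transpose_def k_def)
  have one_two: "1 \<in> {1..n}" "2 \<in> {1..n}" using n by auto
  have conj12: "E 1 * E 2 * P p = P p * (E i * E j)" "E 2 * E 1 * P p = P p * (E j * E i)"
    using E_P[OF one_two(1) p] E_P[OF one_two(2) p] p12 by (metis mult.assoc)+
  then show "E i * E j = E j * E i"
    using P_left_cancel[OF p] E_1_2(1) by metis
  have "P (transpose 1 2) * P p = P p * P (transpose i j)"
    using P_comp[OF transpose_permutes[OF one_two] p] p12
      P_comp[OF p transpose_permutes[OF assms(1,2)]] comp_transpose[OF permutes_inj[OF p], of 1 2]
    by simp
  then have "P p * (E i * E j * P (transpose i j)) = E 1 * E 2 * P (transpose 1 2) * P p"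
    using conj12(1) by (metis mult.assoc)
  then show "E i * E j * P (transpose i j) = E i * E j"
    using P_left_cancel[OF p] conj12(1) E_1_2(2) by metis
qed

section \<open>Products of the conjugates and normal forms\<close>

definition Es :: "nat list \<Rightarrow> 'm" where
  "Es xs = prod_list (map E xs)"

lemma Es_simps: "Es [] = 1" "Es (i # xs) = E i * Es xs"
  by (simp_all add: Es_def)

lemma E_commute:
  assumes "i \<in> {1..n}" "j \<in> {1..n}"
  shows "E i * E j = E j * E i"
  using E_pair(1)[OF assms] by (cases "i = j") auto

lemma E_Es_commute: "i \<in> {1..n} \<Longrightarrow> set xs \<subseteq> {1..n} \<Longrightarrow> E i * Es xs = Es xs * E i"
proof (induction xs)
  case (Cons j xs)
  then have "E i * E j = E j * E i" "E i * Es xs = Es xs * E i" using E_commute[of i j] by auto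
  then show ?case by (metis Es_simps(2) mult.assoc)
qed (simp add: Es_simps)

lemma Es_commute:
  "set xs \<subseteq> {1..n} \<Longrightarrow> set ys \<subseteq> {1..n} \<Longrightarrow> Es xs * Es ys = Es ys * Es xs"
proof (induction xs)
  case (Cons i xs)
  then have "E i * Es ys = Es ys * E i" "Es xs * Es ys = Es ys * Es xs"
    using E_Es_commute[of i ys] by auto
  then show ?case by (metis Es_simps(2) mult.assoc)
qed (simp add: Es_simps)

lemma E_Es_absorb: "set xs \<subseteq> {1..n} \<Longrightarrow> i \<in> set xs \<Longrightarrow> E i * Es xs = Es xs"
proof (induction xs)
  case (Cons j xs)
  show ?case
  proof (cases "i = j")
    case True
    then show ?thesis using Cons.prems E_idem[of j] by (simp add: Es_simps flip: mult.assoc)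
  next
    case False
    then have IH: "E i * Es xs = Es xs" and ij: "E i * E j = E j * E i"
      using Cons E_commute[of i j] by auto
    then show ?thesis by (metis Es_simps(2) mult.assoc)
  qed
qed simp

lemma Es_absorb: "set ys \<subseteq> {1..n} \<Longrightarrow> set xs \<subseteq> set ys \<Longrightarrow> Es xs * Es ys = Es ys"
  by (induction xs) (auto simp: Es_simps mult.assoc E_Es_absorb)

lemma Es_cong: "set xs = set ys \<Longrightarrow> set ys \<subseteq> {1..n} \<Longrightarrow> Es xs = Es ys"
  by (metis Es_absorb Es_commute order_refl)

lemma P_Es:
  assumes "p permutes {1..n}" "set xs \<subseteq> {1..n}"
  shows "P p * Es (map p xs) = Es xs * P p"
  using assms(2)
proof (induction xs)
  case (Cons i xs)
  then have "P p * E (p i) = E i * P p" using E_P[OF _ assms(1)] by simp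
  then show ?case using Cons by (simp add: Es_simps) (metis mult.assoc)
qed (simp add: Es_simps)

text \<open>By idempotence and commutation a factor \<open>E i * E j\<close> can be split off at the
  right end, where it absorbs the transposition.\<close>

lemma Es_P_absorb_transpose:
  assumes "set xs \<subseteq> {1..n}" "i \<in> set xs" "j \<in> set xs" "i \<noteq> j"
  shows "Es xs * P (transpose i j) = Es xs"
proof -
  have "Es xs = Es [i, j] * Es xs" using Es_absorb[of xs "[i, j]"] assms by simp
  also have "\<dots> = Es xs * (E i * E j)"
    using Es_commute[of "[i, j]" xs] assms(1) subsetD[OF assms(1,2)] subsetD[OF assms(1,3)]
    by (simp add: Es_simps)
  finally have *: "Es xs = Es xs * (E i * E j)" .
  have "E i * E j * P (transpose i j) = E i * E j" 
    using E_pair(2) subsetD[OF assms(1,2)] subsetD[OF assms(1,3)] assms(4) .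
  then show ?thesis using * by (metis mult.assoc)
qed

lemma Es_P_absorb:
  assumes "set xs \<subseteq> {1..n}" "p permutes (set xs)"
  shows "Es xs * P p = Es xs"
  using finite_set[of xs] assms(2)
\<comment> \<open>The reverse induction adds the transposition as the map applied first, so that
  \<open>P_comp\<close> places it directly next to \<open>Es xs\<close>.\<close>
proof (induction p rule: permutes_rev_induct)
  case id
  show ?case by (simp only: P_id mult_1_right)
next
  case (swap a b p)
  have "p permutes {1..n}" using swap.hyps assms(1) permutes_subset by blast
  moreover have "transpose a b permutes {1..n}" using swap.hyps assms(1) by (intro transpose_permutes) auto
  ultimately have "Es xs * P (p \<circ> transpose a b) = Es xs * P (transpose a b) * P p"
    by (simp add: P_comp mult.assoc)
  also have "\<dots> = Es xs" using swap assms(1) Es_P_absorb_transpose by simp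
  finally show ?case .
qed

text \<open>Permutations that agree outside \<open>set xs\<close> differ by a permutation of
  \<open>set xs\<close>, which is absorbed. Hence normal forms that describe the same partial
  permutation are equal.\<close>

lemma Es_P_eq:
  assumes "set xs \<subseteq> {1..n}" "set xs = set ys" "p permutes {1..n}" "q permutes {1..n}"
    and "\<And>i. i \<in> {1..n} - set xs \<Longrightarrow> p i = q i"
  shows "Es xs * P p = Es ys * P q"
proof -
  define r where "r = Hilbert_Choice.inv q \<circ> p"
  have "r permutes {1..n}"
    unfolding r_def using assms by (intro permutes_compose permutes_inv)
  then have r: "r permutes (set xs)"
    by (rule permutes_superset) (simp add: r_def assms(5) permutes_inverses[OF assms(4)])
  have "p = q \<circ> r"
    by (simp add: r_def fun_eq_iff permutes_inverses[OF assms(4)])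
  then have "P p = P r * P q"
    using P_comp \<open>r permutes {1..n}\<close> assms(4) by simp
  then have "Es xs * P p = Es xs * P q"
    using Es_P_absorb[OF assms(1) r] by (simp flip: mult.assoc)
  then show ?thesis using Es_cong assms by metis
qed

end

section \<open>Word congruences and invariants of presentations\<close>

text \<open>A separate type lets self-maps under composition be an instance of
  \<open>monoid_mult\<close>, as \<open>sym_inv_relations\<close> demands of its target.\<close>

typedef 'b endo = "UNIV :: ('b \<Rightarrow> 'b) set" ..

setup_lifting type_definition_endo

instantiation endo :: (type) monoid_mult
begin

lift_definition one_endo :: "'b endo" is id .

lift_definition times_endo :: "'b endo \<Rightarrow> 'b endo \<Rightarrow> 'b endo" is "(\<circ>)" .

instance by standard (transfer, simp add: comp_assoc)+

end

section \<open>Congruences and the action of words on their classes\<close>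

lemma word_congruenceD:
  assumes "word_congruence X r"
  shows "r \<subseteq> lists X \<times> lists X" "u \<in> lists X \<Longrightarrow> (u, u) \<in> r" "(u, v) \<in> r \<Longrightarrow> (v, u) \<in> r"
    "(u, v) \<in> r \<Longrightarrow> (v, w) \<in> r \<Longrightarrow> (u, w) \<in> r"
    "(u, v) \<in> r \<Longrightarrow> (u', v') \<in> r \<Longrightarrow> (u @ u', v @ v') \<in> r"
  using assms unfolding word_congruence_def equiv_def
  by (auto simp: refl_on_def dest: symD transD)

text \<open>Serves to show that a congruence on the larger alphabet that contains \<open>R\<close>
  identifies all words over \<open>A\<close> with the same permutation.\<close>

lemma word_congruence_restrict:
  assumes "word_congruence X r" "A \<subseteq> X"
  shows "word_congruence A (r \<inter> lists A \<times> lists A)"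
proof -
  have "equiv (lists A) (r \<inter> lists A \<times> lists A)"
  proof (intro equivI refl_onI symI transI)
    fix u assume "u \<in> lists A"
    moreover from this have "u \<in> lists X" using lists_mono[OF assms(2)] by blast
    ultimately show "(u, u) \<in> r \<inter> lists A \<times> lists A"
      using word_congruenceD(2)[OF assms(1)] by simp
  qed (auto intro: word_congruenceD(3,4)[OF assms(1)])
  then show ?thesis
    using word_congruenceD(5)[OF assms(1)] by (auto simp: word_congruence_def)
qed

lemma generated_congruence_subset:
  "word_congruence X r \<Longrightarrow> Q \<subseteq> r \<Longrightarrow> generated_congruence X Q \<subseteq> r"
  by (auto simp: generated_congruence_def)

text \<open>
  The left regular action of words on the quotient. It turns an arbitrary word congruence into a
  homomorphism to a type of class \<open>monoid_mult\<close>, so that no carrier conditions arise.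
\<close>

definition class_action :: "'a set \<Rightarrow> ('a list \<times> 'a list) set \<Rightarrow> 'a list \<Rightarrow> 'a list set endo" where
  "class_action X r w = Abs_endo (\<lambda>C. if C \<in> lists X // r then r `` ((@) w ` C) else C)"

context
  fixes X :: "'a set" and r
  assumes r: "word_congruence X r"
begin

lemma equiv_r: "equiv (lists X) r"
  using r by (simp add: word_congruence_def)

lemma class_action_class:
  assumes "w \<in> lists X" "u \<in> lists X"
  shows "Rep_endo (class_action X r w) (r `` {u}) = r `` {w @ u}"
proof -
  have "r `` {u} \<in> lists X // r" using assms by (simp add: quotientI)
  moreover have "r `` ((@) w ` (r `` {u})) = r `` {w @ u}"
  proof (intro equalityI subsetI)
    fix z assume "z \<in> r `` ((@) w ` (r `` {u}))"
    then obtain v where v: "(u, v) \<in> r" "(w @ v, z) \<in> r" by auto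
    then have "(w @ u, w @ v) \<in> r" using word_congruenceD(2,5)[OF r] assms(1) by blast
    then show "z \<in> r `` {w @ u}" using v(2) word_congruenceD(4)[OF r] by blast
  next
    fix z assume "z \<in> r `` {w @ u}"
    moreover have "(u, u) \<in> r" using word_congruenceD(2)[OF r] assms(2) .
    ultimately show "z \<in> r `` ((@) w ` (r `` {u}))" by blast
  qed
  ultimately show ?thesis by (simp add: class_action_def Abs_endo_inverse)
qed

text \<open>The action is the identity outside the quotient by definition, which makes this an
  equation on the whole type.\<close>

lemma class_action_Nil: "class_action X r [] = 1"
proof -
  have "r `` C = C" if "C \<in> lists X // r" for C
    using that by (rule quotientE) (use word_congruenceD[OF r] in blast)
  then show ?thesis
    by (simp add: class_action_def one_endo_def id_def cong: if_cong)
qed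

lemma class_action_append:
  assumes "u \<in> lists X" "v \<in> lists X"
  shows "class_action X r (u @ v) = class_action X r u * class_action X r v"
proof -
  have "Rep_endo (class_action X r (u @ v)) C
      = Rep_endo (class_action X r u) (Rep_endo (class_action X r v) C)" for C
  proof (cases "C \<in> lists X // r")
    case True
    then obtain w where "w \<in> lists X" "C = r `` {w}" by (rule quotientE)
    then show ?thesis using assms by (simp add: class_action_class)
  qed (simp add: class_action_def Abs_endo_inverse)
  then show ?thesis
    by (simp add: times_endo.rep_eq fun_eq_iff flip: Rep_endo_inject)
qed

text \<open>Faithfulness: acting on the class of the empty word recovers the class of the acting
  word.\<close>

lemma class_action_eq_iff:
  assumes "u \<in> lists X" "v \<in> lists X"
  shows "class_action X r u = class_action X r v \<longleftrightarrow> (u, v) \<in> r"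
proof
  assume "class_action X r u = class_action X r v"
  then have "r `` {u @ []} = r `` {v @ []}"
    using class_action_class[of _ "[]"] assms by (metis lists.Nil)
  then show "(u, v) \<in> r"
    using assms equiv_r by (simp add: eq_equiv_class)
next
  assume uv: "(u, v) \<in> r"
  have "Rep_endo (class_action X r u) C = Rep_endo (class_action X r v) C" for C
  proof (cases "C \<in> lists X // r")
    case True
    then obtain w where w: "w \<in> lists X" "C = r `` {w}" by (rule quotientE)
    then have "(u @ w, v @ w) \<in> r" using uv word_congruenceD(2,5)[OF r] by blast
    then show ?thesis
      using w assms equiv_class_eq[OF equiv_r] by (simp add: class_action_class)
  qed (simp add: class_action_def Abs_endo_inverse)
  then show "class_action X r u = class_action X r v"
    by (simp add: fun_eq_iff flip: Rep_endo_inject)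
qed

end

lemma word_value_Cons: "word_value M g (a # w) = g a \<otimes>\<^bsub>M\<^esub> word_value M g w"
  by (simp add: word_value_def)

lemma (in monoid) word_congruence_kernel:
  assumes "g \<in> X \<rightarrow> carrier G"
  shows "word_congruence X (word_kernel X G g)"
proof -
  have "equiv (lists X) (word_kernel X G g)"
    by (intro equivI refl_onI symI transI) (auto simp: word_kernel_def)
  then show ?thesis
    using word_value_append[OF assms] by (auto simp: word_congruence_def word_kernel_def)
qed

text \<open>The pairs with equal value, and with equal \<open>T\<close> whenever that value
  satisfies \<open>L\<close>, form a congruence that contains \<open>Q\<close>. Transitivity is
  immediate; compatibility with concatenation uses \<open>comb\<close>, together with
  \<open>factors\<close>, by which the elements violating \<open>L\<close> are closed under
  multiplication by anything.\<close>

lemma presentation_invariant: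
  assumes "monoid M" and pres: "monoid_presentation X Q M g"
    and comb: "\<And>w z. w \<in> lists X \<Longrightarrow> z \<in> lists X \<Longrightarrow>
        T (w @ z) = comb (word_value M g w) (T w) (word_value M g z) (T z)"
    and factors: "\<And>x y. x \<in> carrier M \<Longrightarrow> y \<in> carrier M \<Longrightarrow> L (x \<otimes>\<^bsub>M\<^esub> y) \<Longrightarrow> L x \<and> L y"
    and rel: "\<And>u v. (u, v) \<in> Q \<Longrightarrow> u \<in> lists X \<Longrightarrow> v \<in> lists X \<Longrightarrow>
        word_value M g u = word_value M g v \<Longrightarrow> L (word_value M g u) \<Longrightarrow> T u = T v"
    and w: "w \<in> lists X" "w' \<in> lists X" "word_value M g w = word_value M g w'"
      "L (word_value M g w)"
  shows "T w = T w'"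
proof -
  interpret monoid M by fact
  have g: "g \<in> X \<rightarrow> carrier M" and ker: "word_kernel X M g = generated_congruence X Q"
    using pres by (auto simp: monoid_presentation_def)
  define r where
    "r = {(u, v) \<in> word_kernel X M g. L (word_value M g u) \<longrightarrow> T u = T v}"
  have "word_congruence X r"
    unfolding word_congruence_def
  proof
    show "equiv (lists X) r"
      by (intro equivI refl_onI symI transI) (auto simp: r_def word_kernel_def)
    show "\<forall>(u, v)\<in>r. \<forall>(u', v')\<in>r. (u @ u', v @ v') \<in> r"
    proof clarify
      fix u v u' v' assume "(u, v) \<in> r" "(u', v') \<in> r"
      then show "(u @ u', v @ v') \<in> r"
        using factors[of "word_value M g u" "word_value M g u'"] word_value_closed[OF g]
        by (auto simp: r_def word_kernel_def comb word_value_append[OF g])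
    qed
  qed
  moreover have "Q \<subseteq> word_kernel X M g"
    unfolding ker by (auto simp: generated_congruence_def)
  then have "Q \<subseteq> r"
    using rel by (fastforce simp: r_def word_kernel_def)
  ultimately have "word_kernel X M g \<subseteq> r"
    unfolding ker by (rule generated_congruence_subset)
  moreover have "(w, w') \<in> word_kernel X M g"
    using w by (simp add: word_kernel_def)
  ultimately show ?thesis
    using w(4) by (auto simp: r_def)
qed

section \<open>The presentation\<close>

text \<open>A partial permutation is encoded by the points missing from its domain and some
  permutation that extends it. The extension is not unique, which is the ambiguity that
  \<open>Es_P_eq\<close> resolves.\<close>

definition part_perm :: "nat \<Rightarrow> nat set \<Rightarrow> (nat \<Rightarrow> nat) \<Rightarrow> (nat \<rightharpoonup> nat)" where
  "part_perm n D p = perm_map n p |` (- D)"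

lemma part_perm_apply: "part_perm n D p x = (if x \<in> {1..n} - D then Some (p x) else None)"
  by (auto simp: part_perm_def perm_map_def restrict_map_def)

lemma dom_part_perm: "dom (part_perm n D p) = {1..n} - D"
  by (auto simp: part_perm_apply dom_def)

lemma perm_map_eq_part_perm: "perm_map n p = part_perm n {} p"
  by (simp add: fun_eq_iff part_perm_apply perm_map_def restrict_map_def)

lemma one_eq_part_perm: "\<one>\<^bsub>sym_inv_monoid n\<^esub> = part_perm n {} id"
  by (auto simp: sym_inv_monoid_def part_perm_apply fun_eq_iff restrict_map_def)

lemma part_perm_mult:
  assumes "p permutes {1..n}"
  shows "part_perm n D p \<otimes>\<^bsub>sym_inv_monoid n\<^esub> part_perm n E q = part_perm n (D \<union> p -` E) (q \<circ> p)"
proof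
  fix x
  have "p x \<in> {1..n} \<longleftrightarrow> x \<in> {1..n}" using permutes_in_image[OF assms] .
  then show "(part_perm n D p \<otimes>\<^bsub>sym_inv_monoid n\<^esub> part_perm n E q) x
      = part_perm n (D \<union> p -` E) (q \<circ> p) x"
    by (simp add: sym_inv_monoid_def map_comp_def part_perm_apply del: atLeastAtMost_iff)
qed

lemma part_perm_in_carrier:
  assumes "p permutes {1..n}"
  shows "part_perm n D p \<in> carrier (sym_inv_monoid n)"
proof -
  have "perm_map n p \<in> carrier (sym_inv_monoid n)" using assms by (rule perm_map_in_carrier)
  then show ?thesis
    unfolding part_perm_def sym_inv_monoid_def
    by (auto simp: ran_def restrict_map_def inj_on_def dom_def split: if_splits)
qed

lemma part_perm_eqD:
  assumes "part_perm n D p = part_perm n E q" "D \<subseteq> {1..n}" "E \<subseteq> {1..n}"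
  shows "D = E" and "\<And>i. i \<in> {1..n} - D \<Longrightarrow> p i = q i"
proof -
  have "{1..n} - D = {1..n} - E" using arg_cong[OF assms(1), of dom] by (simp add: dom_part_perm)
  then show "D = E" using assms(2,3) by blast
  fix i assume "i \<in> {1..n} - D"
  then show "p i = q i" using fun_cong[OF assms(1), of i] \<open>D = E\<close> by (simp add: part_perm_apply)
qed

text \<open>Domain and range have the same size, hence so do their complements, and a bijection
  between the complements extends \<open>f\<close>.\<close>

lemma sym_inv_monoid_part_perm:
  assumes "f \<in> carrier (sym_inv_monoid n)"
  obtains p where "p permutes {1..n}" "f = part_perm n ({1..n} - dom f) p"
proof -
  have f: "dom f \<subseteq> {1..n}" "ran f \<subseteq> {1..n}" "inj_on f (dom f)"
    using assms by (auto simp: sym_inv_monoid_def)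
  have fin: "finite (dom f)" "finite (ran f)" using f finite_subset by blast+
  have bij1: "bij_betw (\<lambda>x. the (f x)) (dom f) (ran f)"
    unfolding bij_betw_def
  proof
    show "inj_on (\<lambda>x. the (f x)) (dom f)"
    proof (rule inj_onI)
      fix x y assume xy: "x \<in> dom f" "y \<in> dom f" "the (f x) = the (f y)"
      then have "f x = f y" by auto
      then show "x = y" using f(3) xy by (auto dest: inj_onD)
    qed
    show "(\<lambda>x. the (f x)) ` dom f = ran f"
    proof (intro equalityI subsetI)
      fix y assume "y \<in> ran f"
      then obtain x where "f x = Some y" by (auto simp: ran_def)
      then show "y \<in> (\<lambda>x. the (f x)) ` dom f" by (intro image_eqI[of _ _ x]) auto
    qed (auto simp: ran_def)
  qed
  then have "card (dom f) = card (ran f)" by (rule bij_betw_same_card)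
  then have "card ({1..n} - dom f) = card ({1..n} - ran f)"
    using f fin by (simp add: card_Diff_subset)
  then obtain k where k: "bij_betw k ({1..n} - dom f) ({1..n} - ran f)"
    using finite_same_card_bij by blast
  define p where "p x = (if x \<in> dom f then the (f x) else if x \<in> {1..n} then k x else x)" for x
  have "bij_betw p (dom f) (ran f)"
    using bij1 by (rule bij_betw_cong[THEN iffD1, rotated]) (simp add: p_def)
  moreover have "bij_betw p ({1..n} - dom f) ({1..n} - ran f)"
    using k by (rule bij_betw_cong[THEN iffD1, rotated]) (simp add: p_def)
  ultimately have "bij_betw p (dom f \<union> ({1..n} - dom f)) (ran f \<union> ({1..n} - ran f))"
    by (rule bij_betw_combine) blast
  moreover have "dom f \<union> ({1..n} - dom f) = {1..n}" "ran f \<union> ({1..n} - ran f) = {1..n}"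
    using f by auto
  ultimately have "bij_betw p {1..n} {1..n}" by simp
  then have "p permutes {1..n}"
    by (rule bij_imp_permutes) (use f(1) in \<open>auto simp: p_def\<close>)
  moreover have "f = part_perm n ({1..n} - dom f) p"
    using f(1) by (auto simp: fun_eq_iff part_perm_apply p_def)
  ultimately show ?thesis by (rule that)
qed

lemma sym_submonoid_simps:
  "\<one>\<^bsub>sym_submonoid n\<^esub> = \<one>\<^bsub>sym_inv_monoid n\<^esub>"
  "x \<otimes>\<^bsub>sym_submonoid n\<^esub> y = x \<otimes>\<^bsub>sym_inv_monoid n\<^esub> y"
  "carrier (sym_submonoid n) = perm_map n ` {p. p permutes {1..n}}"
  by (simp_all add: sym_submonoid_def)

lemma word_value_sym_submonoid: "word_value (sym_submonoid n) g w = word_value (sym_inv_monoid n) g w"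
  by (induction w) (simp_all add: word_value_Nil word_value_Cons sym_submonoid_simps)

lemma word_value_cong:
  "(\<And>a. a \<in> set w \<Longrightarrow> g a = g' a) \<Longrightarrow> word_value M g w = word_value M g' w"
  by (induction w) (simp_all add: word_value_Nil word_value_Cons)

text \<open>After the relations are verified in the monoid and surjectivity is shown, the kernel is
  compared with an arbitrary congruence \<open>r\<close> containing the relations: modulo
  \<open>r\<close> each word has a normal form, and its value determines the normal form.\<close>

lemma presentation_of_sym_inv_monoid:
  fixes \<eta> :: 'a and g :: "'a \<Rightarrow> (nat \<rightharpoonup> nat)"
  assumes n: "3 \<le> n"
    and presA: "monoid_presentation A R (sym_submonoid n) g"
    and \<eta>: "\<eta> \<notin> A"
    and t: "t \<in> lists A" "word_value (sym_submonoid n) g t = cycle_map n [2, 3]"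
    and c: "c \<in> lists A" "word_value (sym_submonoid n) g c = cycle_map n [2..<Suc n]"
    and s: "s \<in> lists A" "word_value (sym_submonoid n) g s = cycle_map n [1, 2]"
  defines "Q \<equiv> R \<union> {(t @ [\<eta>], [\<eta>] @ t),
                (c @ [\<eta>], [\<eta>, \<eta>] @ c),
                (s @ [\<eta>] @ s @ [\<eta>] @ s @ [\<eta>] @ s, [\<eta>] @ s @ [\<eta>])}"
  shows "monoid_presentation (A \<union> {\<eta>}) Q (sym_inv_monoid n) (g(\<eta> := Some |` {2..n}))"
proof -
  define I where "I = sym_inv_monoid n"
  define G where "G = g(\<eta> := Some |` {2..n})"
  define X where "X = A \<union> {\<eta>}"
  interpret monoid I unfolding I_def by (rule monoid_sym_inv_monoid)
  have A: "finite A" "finite R" "R \<subseteq> lists A \<times> lists A" "g \<in> A \<rightarrow> carrier (sym_submonoid n)"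
    "word_value (sym_submonoid n) g ` lists A = carrier (sym_submonoid n)"
    "word_kernel A (sym_submonoid n) g = generated_congruence A R"
    using presA by (simp_all add: monoid_presentation_def)
  have G\<eta>: "G \<eta> = part_perm n {1} id"
    by (auto simp: G_def fun_eq_iff part_perm_apply restrict_map_def)
  have GA: "\<exists>p. p permutes {1..n} \<and> G a = part_perm n {} p" if "a \<in> A" for a
    using A(4) that \<eta> by (auto simp: G_def Pi_iff sym_submonoid_simps perm_map_eq_part_perm)
  have GX: "G \<in> X \<rightarrow> carrier I"
  proof
    fix a assume "a \<in> X"
    then consider "a \<in> A" | "a = \<eta>" by (auto simp: X_def)
    then show "G a \<in> carrier I"
      using GA[of a] part_perm_in_carrier permutes_id by cases (auto simp: I_def G\<eta>)
  qed
  have AX: "lists A \<subseteq> lists X" by (auto simp: X_def)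
  have val_A: "word_value I G w = word_value (sym_submonoid n) g w" if "w \<in> lists A" for w
    unfolding word_value_sym_submonoid I_def G_def
    by (rule word_value_cong) (use that \<eta> in auto)
  have val_append: "word_value I G (u @ v) = word_value I G u \<otimes>\<^bsub>I\<^esub> word_value I G v"
    if "u \<in> lists X" "v \<in> lists X" for u v
    using word_value_append[OF GX that] .
  have val_\<eta>: "word_value I G [\<eta>] = part_perm n {1} id"
    using word_value_singleton[of G \<eta>] GX G\<eta> by (simp add: X_def)
  have perm_word: "\<exists>w \<in> lists A. word_value I G w = part_perm n {} p"
    if "p permutes {1..n}" for p
  proof -
    have "perm_map n p \<in> word_value (sym_submonoid n) g ` lists A"
      unfolding A(5) using that by (simp add: sym_submonoid_simps)
    then show ?thesis using val_A by (auto simp: perm_map_eq_part_perm)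
  qed
  define T where "T = (transpose 2 3 :: nat \<Rightarrow> nat)"
  define C where "C = cycle_of_list [2..<Suc n]"
  define V where "V = (transpose 1 2 :: nat \<Rightarrow> nat)"
  have perms: "T permutes {1..n}" "C permutes {1..n}" "V permutes {1..n}"
  proof -
    show "T permutes {1..n}" "V permutes {1..n}"
      unfolding T_def V_def using n by (intro permutes_swap_id; simp)+
    show "C permutes {1..n}"
      unfolding C_def by (rule permutes_subset[OF cycle_permutes]) auto
  qed
  have vals: "word_value I G t = part_perm n {} T" "word_value I G c = part_perm n {} C"
    "word_value I G s = part_perm n {} V"
    using t c s val_A
    by (simp_all add: cycle_map_def perm_map_eq_part_perm T_def C_def V_def del: upt_Suc)
  have tX: "t \<in> lists X" "c \<in> lists X" "s \<in> lists X" "[\<eta>] \<in> lists X"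
    using t c s AX by (auto simp: X_def)
  have mult: "part_perm n D p \<otimes>\<^bsub>I\<^esub> part_perm n E q = part_perm n (D \<union> p -` E) (q \<circ> p)"
    if "p permutes {1..n}" for D E p q
    unfolding I_def using that by (rule part_perm_mult)

  have "word_value I G (t @ [\<eta>]) = word_value I G ([\<eta>] @ t)"
  proof -
    have "T -` {1} = {1}" by (auto simp: T_def transpose_def split: if_splits)
    then show ?thesis
      using tX by (simp add: val_append vals val_\<eta> mult perms permutes_id del: append.simps)
  qed
  moreover have "word_value I G (c @ [\<eta>]) = word_value I G ([\<eta>, \<eta>] @ c)"
  proof -
    have "C 1 = 1" unfolding C_def by (rule id_outside_supp) simp
    then have "C x = 1 \<longleftrightarrow> x = 1" for x using permutes_inj[OF perms(2)] by (metis injD)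
    then have "C -` {1} = {1}" by blast
    then have "word_value I G (c @ [\<eta>]) = word_value I G ([\<eta>] @ [\<eta>] @ c)"
      using tX by (simp add: val_append vals val_\<eta> mult perms permutes_id del: append.simps)
    then show ?thesis by simp
  qed
  moreover have "word_value I G (s @ [\<eta>] @ s @ [\<eta>] @ s @ [\<eta>] @ s) = word_value I G ([\<eta>] @ s @ [\<eta>])"
  proof -
    have V: "V -` {1} = {2}" "V -` {1, 2} = {1, 2}" "V \<circ> V = id"
      by (auto simp: V_def transpose_def split: if_splits)
    \<comment> \<open>The left side involves four factors \<open>V\<close> and the right side one.
      Both sides have domain {3, ..., n}, where \<open>V\<close> is the identity.\<close>
    have "V x = x" if "x \<in> {1..n} - {1, 2}" for x using that by (auto simp: V_def)
    then have "part_perm n {1, 2} V = part_perm n {1, 2} id"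
      by (auto simp: fun_eq_iff part_perm_apply)
    moreover have "V \<circ> (V \<circ> p) = p" for p using V(3) by (simp flip: comp_assoc)
    ultimately show ?thesis
      using tX V
      by (simp add: val_append vals val_\<eta> mult perms permutes_id permutes_compose vimage_comp
          insert_commute del: append.simps)
  qed
  moreover have "R \<subseteq> word_kernel X I G"
  proof -
    have "R \<subseteq> word_kernel A (sym_submonoid n) g"
      unfolding A(6) by (auto simp: generated_congruence_def)
    moreover have "word_kernel A (sym_submonoid n) g \<subseteq> word_kernel X I G"
    proof clarify
      fix u v assume "(u, v) \<in> word_kernel A (sym_submonoid n) g"
      then have uv: "u \<in> lists A" "v \<in> lists A"
        "word_value (sym_submonoid n) g u = word_value (sym_submonoid n) g v"
        unfolding word_kernel_def by blast+
      then have "word_value I G u = word_value I G v" by (simp only: val_A)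
      then show "(u, v) \<in> word_kernel X I G"
        unfolding word_kernel_def using uv AX by blast
    qed
    ultimately show ?thesis by blast
  qed
  ultimately have Q_ker: "Q \<subseteq> word_kernel X I G"
    using tX unfolding Q_def by (auto simp: word_kernel_def)

  have "word_value I G ` lists X = carrier I"
  proof (intro equalityI subsetI)
    fix f assume "f \<in> carrier I"
    then obtain p where p: "p permutes {1..n}" "f = part_perm n ({1..n} - dom f) p"
      unfolding I_def by (rule sym_inv_monoid_part_perm)
    \<comment> \<open>The restrictions of the identity are built by removing one point at a time:
      \<open>v @ [\<eta>] @ v\<close> represents the idempotent undefined at \<open>i\<close>. A
      word for \<open>p\<close> is appended afterwards.\<close>
    have "\<exists>w \<in> lists X. word_value I G w = part_perm n D id"
      if "finite D" "D \<subseteq> {1..n}" for D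
      using that
    proof (induction D)
      case empty
      then show ?case using perm_word[OF permutes_id] AX by blast
    next
      case (insert i D)
      then obtain w where w: "w \<in> lists X" "word_value I G w = part_perm n D id"
        by blast
      have tr: "transpose 1 i permutes {1..n}"
        using insert.prems by (intro permutes_swap_id) auto
      then obtain v where v: "v \<in> lists A" "word_value I G v = part_perm n {} (transpose 1 i)"
        using perm_word by blast
      have vX: "v \<in> lists X" using v(1) AX by blast
      have "transpose 1 i -` insert 1 (transpose 1 i -` D) = insert i D"
        by (auto simp: transpose_eq_iff)
      then have "word_value I G (v @ [\<eta>] @ v @ w) = part_perm n (insert i D) id"
        using v w vX tX by (simp add: val_append val_\<eta> mult tr permutes_id del: append.simps)
      moreover have "v @ [\<eta>] @ v @ w \<in> lists X" using w vX tX by simp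
      ultimately show ?case by blast
    qed
    then obtain w where w: "w \<in> lists X" "word_value I G w = part_perm n ({1..n} - dom f) id"
      by (meson Diff_subset finite_Diff finite_atLeastAtMost)
    obtain v where v: "v \<in> lists A" "word_value I G v = part_perm n {} p"
      using perm_word p(1) by blast
    have vX: "v \<in> lists X" using v(1) AX by blast
    have "word_value I G (w @ v) = f"
      using v w vX p(2) by (simp add: val_append mult permutes_id)
    moreover have "w @ v \<in> lists X" using w vX by simp
    ultimately show "f \<in> word_value I G ` lists X" by blast
  qed (auto intro: word_value_closed[OF GX])

  moreover have "word_kernel X I G = generated_congruence X Q"
  proof
    show "generated_congruence X Q \<subseteq> word_kernel X I G"
      using word_congruence_kernel[OF GX] Q_ker by (rule generated_congruence_subset)
    \<comment> \<open>The generated congruence is an intersection, so one congruence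
      \<open>r\<close> is treated at a time.\<close>
    have "word_kernel X I G \<subseteq> r" if r: "word_congruence X r" and Qr: "Q \<subseteq> r" for r
    proof -
      define cl where "cl = class_action X r"
      have cl_append: "cl (u @ v) = cl u * cl v" if "u \<in> lists X" "v \<in> lists X" for u v
        unfolding cl_def using that by (rule class_action_append[OF r])
      have cl_eq: "cl u = cl v" if "(u, v) \<in> r" for u v
        using class_action_eq_iff[OF r] word_congruenceD(1)[OF r] that unfolding cl_def by blast
      have ker_A: "word_kernel A (sym_submonoid n) g \<subseteq> r"
      proof -
        have "R \<subseteq> r \<inter> lists A \<times> lists A" using A(3) Qr by (auto simp: Q_def)
        then show ?thesis
          using generated_congruence_subset[OF word_congruence_restrict[OF r]] A(6)
          by (auto simp: X_def)
      qed
      \<comment> \<open>The choice of the word does not affect \<open>P\<close>: by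
        \<open>ker_A\<close> all words over \<open>A\<close> for the same permutation are
        congruent.\<close>
      define W where "W p = (SOME w. w \<in> lists A \<and> word_value I G w = part_perm n {} p)" for p
      have W: "W p \<in> lists A" "word_value I G (W p) = part_perm n {} p"
        if "p permutes {1..n}" for p
        using someI_ex[of "\<lambda>w. w \<in> lists A \<and> word_value I G w = part_perm n {} p"]
          perm_word[OF that] unfolding W_def by blast+
      define P where "P p = cl (W p)" for p
      have cl_P: "cl w = P p"
        if "w \<in> lists A" "word_value I G w = part_perm n {} p" "p permutes {1..n}" for w p
        unfolding P_def
        by (rule cl_eq, rule subsetD[OF ker_A])
          (use that W[OF that(3)] val_A in \<open>simp add: word_kernel_def\<close>)
      interpret sym_inv_relations n P "cl [\<eta>]"
      proof
        show "3 \<le> n" by fact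
        have "cl [] = P id"
          by (rule cl_P) (simp_all add: word_value_Nil I_def one_eq_part_perm permutes_id)
        then show "P id = 1"
          using class_action_Nil[OF r] by (simp add: cl_def)
        fix p q :: "nat \<Rightarrow> nat" assume pq: "p permutes {1..n}" "q permutes {1..n}"
        have WX: "W p \<in> lists X" "W q \<in> lists X" using W pq AX by blast+
        have "cl (W p @ W q) = P (q \<circ> p)"
          using pq W WX by (intro cl_P) (simp_all add: val_append mult permutes_compose)
        then show "P (q \<circ> p) = P p * P q"
          using cl_append[OF WX] by (simp add: P_def)
      next
        have P: "P T = cl t" "P C = cl c" "P V = cl s"
          using cl_P t c s vals perms by auto
        have "cl (t @ [\<eta>]) = cl ([\<eta>] @ t)" "cl (c @ [\<eta>]) = cl ([\<eta>, \<eta>] @ c)"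
          "cl (s @ [\<eta>] @ s @ [\<eta>] @ s @ [\<eta>] @ s) = cl ([\<eta>] @ s @ [\<eta>])"
          using Qr unfolding Q_def by (intro cl_eq; simp)+
        moreover have "cl ([\<eta>, \<eta>] @ c) = cl ([\<eta>] @ [\<eta>] @ c)" by simp
        ultimately have eqs: "P T * cl [\<eta>] = cl [\<eta>] * P T" "P C * cl [\<eta>] = cl [\<eta>] * cl [\<eta>] * P C"
          "P V * cl [\<eta>] * P V * cl [\<eta>] * P V * cl [\<eta>] * P V = cl [\<eta>] * P V * cl [\<eta>]"
          using tX unfolding P by (simp_all add: cl_append mult.assoc del: append.simps)
        then show "P (transpose 2 3) * cl [\<eta>] = cl [\<eta>] * P (transpose 2 3)"
          "P (cycle_of_list [2..<Suc n]) * cl [\<eta>] = cl [\<eta>] * cl [\<eta>] * P (cycle_of_list [2..<Suc n])"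
          "P (transpose 1 2) * cl [\<eta>] * P (transpose 1 2) * cl [\<eta>] * P (transpose 1 2) * cl [\<eta>]
            * P (transpose 1 2) = cl [\<eta>] * P (transpose 1 2) * cl [\<eta>]"
          unfolding T_def C_def V_def .
      qed
      \<comment> \<open>Words grow at the left: \<eta> adds the index 1, and a permutation
        \<open>q\<close> moves to the right past the conjugates, which replaces their indices by
        preimages under \<open>q\<close>.\<close>
      have normal: "\<exists>xs p. set xs \<subseteq> {1..n} \<and> p permutes {1..n} \<and> cl w = Es xs * P p
          \<and> word_value I G w = part_perm n (set xs) p" if "w \<in> lists X" for w
        using that
      proof (induction w)
        case Nil
        have "cl [] = 1" using class_action_Nil[OF r] by (simp only: cl_def)
        then have "cl [] = Es [] * P id" by (simp only: Es_simps P_id mult_1_left)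
        moreover have "word_value I G [] = part_perm n (set []) id" "set [] \<subseteq> {1..n}"
          by (simp_all only: word_value_Nil I_def one_eq_part_perm list.set empty_subsetI)
        ultimately show ?case using permutes_id[of "{1..n}"] by metis
      next
        case (Cons a w)
        then obtain xs p where xs: "set xs \<subseteq> {1..n}" "p permutes {1..n}" "cl w = Es xs * P p"
          "word_value I G w = part_perm n (set xs) p" and w: "w \<in> lists X" and a: "a \<in> X"
          by auto
        have cl: "cl (a # w) = cl [a] * cl w" using cl_append[of "[a]" w] w a by simp
        have val: "word_value I G (a # w) = G a \<otimes>\<^bsub>I\<^esub> part_perm n (set xs) p"
          using xs by (simp add: word_value_Cons)
        show ?case
        proof (cases "a = \<eta>")
          case True
          then have "cl (a # w) = Es (1 # xs) * P p"
            using cl xs(3) by (simp add: Es_simps E_1 mult.assoc)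
          moreover have "word_value I G (a # w) = part_perm n (set (1 # xs)) p"
            using val True by (simp add: G\<eta> mult permutes_id)
          ultimately show ?thesis
            using xs n by (intro exI[of _ "1 # xs"] exI[of _ p]) auto
        next
          case False
          then have "a \<in> A" using a by (simp add: X_def)
          then obtain q where q: "q permutes {1..n}" "G a = part_perm n {} q" using GA by blast
          have inv_q: "inv_into UNIV q permutes {1..n}" using q(1) by (rule permutes_inv)
          have q_inv: "q (inv_into UNIV q i) = i" "inv_into UNIV q (q i) = i" for i
            using permutes_inverses[OF q(1)] by auto
          define ys where "ys = map (inv_into UNIV q) xs"
          have ys: "map q ys = xs" by (simp add: ys_def q_inv comp_def)
          have set_ys: "set ys \<subseteq> {1..n}"
            unfolding ys_def using xs(1) permutes_in_image[OF inv_q] by auto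
          have "cl [a] = P q"
            using \<open>a \<in> A\<close> q word_value_singleton[of G a, OF funcset_mem[OF GX a]]
            by (intro cl_P) simp_all
          then have "cl (a # w) = P q * Es (map q ys) * P p"
            using cl xs(3) ys by (simp add: mult.assoc)
          also have "\<dots> = Es ys * P (p \<circ> q)"
            using P_Es[OF q(1) set_ys] P_comp[OF q(1) xs(2)] by (simp add: mult.assoc)
          finally have "cl (a # w) = Es ys * P (p \<circ> q)" .
          moreover have "q -` set xs = set ys"
            unfolding ys_def using q_inv by (auto simp: image_iff) metis
          then have "word_value I G (a # w) = part_perm n (set ys) (p \<circ> q)"
            using val q by (simp add: mult)
          ultimately show ?thesis
            using set_ys permutes_compose[OF q(1) xs(2)] by blast
        qed
      qed
      show ?thesis
      proof
        fix uv assume "uv \<in> word_kernel X I G"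
        then obtain u v where uv: "uv = (u, v)" "u \<in> lists X" "v \<in> lists X"
          "word_value I G u = word_value I G v"
          by (auto simp: word_kernel_def)
        obtain xs p where xs: "set xs \<subseteq> {1..n}" "p permutes {1..n}" "cl u = Es xs * P p"
          "word_value I G u = part_perm n (set xs) p"
          using normal uv by blast
        obtain ys q where ys: "set ys \<subseteq> {1..n}" "q permutes {1..n}" "cl v = Es ys * P q"
          "word_value I G v = part_perm n (set ys) q"
          using normal uv by blast
        have eq: "part_perm n (set xs) p = part_perm n (set ys) q" using uv xs ys by simp
        have "cl u = cl v"
          unfolding xs(3) ys(3)
          using xs ys part_perm_eqD[OF eq] by (intro Es_P_eq) auto
        then show "uv \<in> r"
          using class_action_eq_iff[OF r] uv unfolding cl_def by blast
      qed
    qed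
    then show "word_kernel X I G \<subseteq> generated_congruence X Q"
      unfolding generated_congruence_def by blast
  qed
  moreover have "finite X" "finite Q" "Q \<subseteq> lists X \<times> lists X"
    using A Q_ker by (auto simp: X_def Q_def word_kernel_def)
  ultimately show ?thesis
    using GX unfolding X_def G_def I_def by (simp add: monoid_presentation_def)
qed

section \<open>Rank and sign\<close>

text \<open>By injectivity this is also the size of the image. The domain is convenient because it
  can only shrink when a factor is multiplied on the right.\<close>

definition rank :: "(nat \<rightharpoonup> nat) \<Rightarrow> nat" where
  "rank f = card (dom f)"

lemma rank_part_perm: "D \<subseteq> {1..n} \<Longrightarrow> rank (part_perm n D p) = n - card D"
  by (simp add: rank_def dom_part_perm card_Diff_subset finite_subset)

lemma sym_inv_monoid_mult_apply:
  "(f \<otimes>\<^bsub>sym_inv_monoid n\<^esub> h) x = (case f x of None \<Rightarrow> None | Some y \<Rightarrow> h y)"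
  by (simp add: sym_inv_monoid_def map_comp_def)

lemma sym_inv_monoid_carrierD:
  assumes "f \<in> carrier (sym_inv_monoid n)"
  shows "dom f \<subseteq> {1..n}" "ran f \<subseteq> {1..n}" "inj_on f (dom f)" "finite (dom f)"
  using assms finite_subset[of "dom f" "{1..n}"] by (auto simp: sym_inv_monoid_def)

lemma rank_le: "f \<in> carrier (sym_inv_monoid n) \<Longrightarrow> rank f \<le> n"
  using sym_inv_monoid_carrierD(1)[of f n] card_mono[of "{1..n}" "dom f"] by (simp add: rank_def)

lemma dom_mult_subset: "dom (f \<otimes>\<^bsub>sym_inv_monoid n\<^esub> h) \<subseteq> dom f"
  by (auto simp: sym_inv_monoid_mult_apply dom_def split: option.splits)

lemma rank_mult_le:
  assumes "f \<in> carrier (sym_inv_monoid n)" "h \<in> carrier (sym_inv_monoid n)"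
  shows "rank (f \<otimes>\<^bsub>sym_inv_monoid n\<^esub> h) \<le> rank f" "rank (f \<otimes>\<^bsub>sym_inv_monoid n\<^esub> h) \<le> rank h"
proof -
  note f = sym_inv_monoid_carrierD[OF assms(1)] and h = sym_inv_monoid_carrierD[OF assms(2)]
  show "rank (f \<otimes>\<^bsub>sym_inv_monoid n\<^esub> h) \<le> rank f"
    unfolding rank_def using f(4) by (rule card_mono[OF _ dom_mult_subset])
  let ?fh = "f \<otimes>\<^bsub>sym_inv_monoid n\<^esub> h"
  have sub: "f ` dom ?fh \<subseteq> Some ` dom h"
    by (force simp: sym_inv_monoid_mult_apply dom_def split: option.splits)
  have "card (dom ?fh) = card (f ` dom ?fh)"
    using inj_on_subset[OF f(3) dom_mult_subset] by (simp add: card_image)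
  also have "\<dots> \<le> card (Some ` dom h)"
    using h(4) sub by (intro card_mono) auto
  also have "\<dots> = card (dom h)" by (simp add: card_image)
  finally show "rank ?fh \<le> rank h" by (simp add: rank_def)
qed

lemma full_rank:
  assumes "f \<in> carrier (sym_inv_monoid n)" "rank f = n"
  obtains p where "p permutes {1..n}" "f = part_perm n {} p"
proof -
  have "dom f = {1..n}"
    using assms sym_inv_monoid_carrierD(1)[OF assms(1)]
    by (intro card_subset_eq) (simp_all add: rank_def)
  then show ?thesis
    using sym_inv_monoid_part_perm[OF assms(1)] that by (metis Diff_cancel)
qed

lemma rank_perm [simp]: "rank (part_perm n {} p) = n"
  by (simp add: rank_part_perm)

lemma rank_mult_full:
  assumes f: "f \<in> carrier (sym_inv_monoid n)" and h: "h \<in> carrier (sym_inv_monoid n)"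
    and "rank f = n"
  shows "rank (f \<otimes>\<^bsub>sym_inv_monoid n\<^esub> h) = rank h"
proof (rule antisym)
  interpret monoid "sym_inv_monoid n" by (rule monoid_sym_inv_monoid)
  obtain p where p: "p permutes {1..n}" "f = part_perm n {} p"
    using full_rank[OF f assms(3)] .
  define f' where "f' = part_perm n {} (inv_into UNIV p)"
  have "inv_into UNIV p permutes {1..n}" using p(1) by (rule permutes_inv)
  then have f': "f' \<in> carrier (sym_inv_monoid n)"
    "f' \<otimes>\<^bsub>sym_inv_monoid n\<^esub> f = \<one>\<^bsub>sym_inv_monoid n\<^esub>"
    unfolding f'_def p(2)
    by (simp_all add: part_perm_in_carrier part_perm_mult one_eq_part_perm permutes_inv_o[OF p(1)]
        del: id_apply)
  show "rank (f \<otimes>\<^bsub>sym_inv_monoid n\<^esub> h) \<le> rank h" using f h by (rule rank_mult_le)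
  have "h = f' \<otimes>\<^bsub>sym_inv_monoid n\<^esub> (f \<otimes>\<^bsub>sym_inv_monoid n\<^esub> h)"
    using f h f' by (simp flip: m_assoc)
  then show "rank h \<le> rank (f \<otimes>\<^bsub>sym_inv_monoid n\<^esub> h)"
    using rank_mult_le(2)[OF f'(1) m_closed[OF f h]] by simp
qed

lemma rank_mult_eq_full_iff:
  assumes "f \<in> carrier (sym_inv_monoid n)" "h \<in> carrier (sym_inv_monoid n)"
  shows "rank (f \<otimes>\<^bsub>sym_inv_monoid n\<^esub> h) = n \<longleftrightarrow> rank f = n \<and> rank h = n"
  using rank_mult_le[OF assms] rank_le[OF assms(1)] rank_le[OF assms(2)] rank_mult_full[OF assms]
  by auto

text \<open>The value of \<open>psign\<close> at elements of rank below \<open>n\<close> is irrelevant.\<close>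

definition psign :: "(nat \<rightharpoonup> nat) \<Rightarrow> int" where
  "psign f = sign (\<lambda>x. case f x of None \<Rightarrow> x | Some y \<Rightarrow> y)"

lemma psign_perm:
  assumes "p permutes {1..n}"
  shows "psign (part_perm n {} p) = sign p"
proof -
  have "(\<lambda>x. case part_perm n {} p x of None \<Rightarrow> x | Some y \<Rightarrow> y) = p"
    using permutes_not_in[OF assms] by (auto simp: fun_eq_iff part_perm_apply)
  then show ?thesis by (simp add: psign_def)
qed

lemma psign_mult:
  assumes "f \<in> carrier (sym_inv_monoid n)" "h \<in> carrier (sym_inv_monoid n)"
    and "rank f = n" "rank h = n"
  shows "psign (f \<otimes>\<^bsub>sym_inv_monoid n\<^esub> h) = psign f * psign h"
proof -
  obtain p where p: "p permutes {1..n}" "f = part_perm n {} p"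
    using full_rank[OF assms(1,3)] .
  obtain q where q: "q permutes {1..n}" "h = part_perm n {} q"
    using full_rank[OF assms(2,4)] .
  have "permutation p" "permutation q"
    using p(1) q(1) by (auto intro: permutes_imp_permutation[of "{1..n}"])
  then have "sign (q \<circ> p) = sign p * sign q" by (simp add: sign_compose)
  then show ?thesis
    unfolding p(2) q(2)
    using psign_perm[OF permutes_compose[OF p(1) q(1)]] psign_perm[OF p(1)] psign_perm[OF q(1)]
    by (simp add: part_perm_mult[OF p(1)])
qed

lemma psign_cases: "psign f = 1 \<or> psign f = -1"
  by (simp add: psign_def sign_def)

section \<open>Words over a presentation of the symmetric inverse monoid\<close>

locale presented_sym_inv_monoid =
  fixes n :: nat and X :: "'a set" and Q and g :: "'a \<Rightarrow> (nat \<rightharpoonup> nat)"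
  assumes n: "3 \<le> n"
    and pres: "monoid_presentation X Q (sym_inv_monoid n) g"
begin

sublocale monoid "sym_inv_monoid n" by (rule monoid_sym_inv_monoid)

abbreviation val :: "'a list \<Rightarrow> (nat \<rightharpoonup> nat)" where
  "val \<equiv> word_value (sym_inv_monoid n) g"

lemma g_closed: "g \<in> X \<rightarrow> carrier (sym_inv_monoid n)"
  using pres by (simp add: monoid_presentation_def)

lemma val_closed: "w \<in> lists X \<Longrightarrow> val w \<in> carrier (sym_inv_monoid n)"
  by (rule word_value_closed[OF g_closed])

lemma val_append:
  "u \<in> lists X \<Longrightarrow> v \<in> lists X \<Longrightarrow> val (u @ v) = val u \<otimes>\<^bsub>sym_inv_monoid n\<^esub> val v"
  by (rule word_value_append[OF g_closed])

lemma val_singleton: "a \<in> X \<Longrightarrow> val [a] = g a"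
  using g_closed by (intro word_value_singleton) auto

lemma obtain_word:
  assumes "f \<in> carrier (sym_inv_monoid n)"
  obtains w where "w \<in> lists X" "val w = f"
proof -
  have "f \<in> val ` lists X" using pres assms by (simp add: monoid_presentation_def)
  then show ?thesis using that by blast
qed

lemma relation:
  assumes "(u, v) \<in> Q"
  shows "u \<in> lists X" "v \<in> lists X" "val u = val v"
proof -
  have "(u, v) \<in> word_kernel X (sym_inv_monoid n) g"
    using pres assms by (auto simp: monoid_presentation_def generated_congruence_def)
  then show "u \<in> lists X" "v \<in> lists X" "val u = val v"
    by (simp_all add: word_kernel_def)
qed

lemma rank_letter:
  assumes "w \<in> lists X" "a \<in> set w"
  shows "rank (val w) \<le> rank (g a)"
  using assms
proof (induction w)
  case (Cons b w)
  then have "g b \<in> carrier (sym_inv_monoid n)" "val w \<in> carrier (sym_inv_monoid n)"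
    using g_closed val_closed by auto
  then show ?case
    using rank_mult_le[of "g b" n "val w"] Cons by (auto simp: word_value_Cons)
qed simp

text \<open>For letters of \<open>X\<close> the rank is at most \<open>n\<close>, so these are the
  letters that represent non-units, in their order of occurrence.\<close>

definition singular :: "'a list \<Rightarrow> 'a list" where
  "singular w = filter (\<lambda>a. rank (g a) \<noteq> n) w"

lemma singular_append: "singular (u @ v) = singular u @ singular v"
  by (simp add: singular_def)

lemma singular_Nil_iff: "w \<in> lists X \<Longrightarrow> singular w = [] \<longleftrightarrow> rank (val w) = n"
proof (induction w)
  case Nil
  show ?case by (simp add: singular_def word_value_Nil one_eq_part_perm)
next
  case (Cons a w)
  then have "g a \<in> carrier (sym_inv_monoid n)" "val w \<in> carrier (sym_inv_monoid n)"
    using g_closed val_closed by auto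
  then show ?case
    using Cons by (auto simp: word_value_Cons rank_mult_eq_full_iff singular_def)
qed

text \<open>A relation applied inside a word of rank at least \<open>k\<close> has rank at least
  \<open>k\<close> itself, so only such relations have to respect \<open>T\<close>.\<close>

lemma invariant:
  assumes comb: "\<And>w z. w \<in> lists X \<Longrightarrow> z \<in> lists X \<Longrightarrow> T (w @ z) = comb (val w) (T w) (val z) (T z)"
    and rel: "\<And>u v. (u, v) \<in> Q \<Longrightarrow> k \<le> rank (val u) \<Longrightarrow> T u = T v"
    and w: "w \<in> lists X" "w' \<in> lists X" "val w = val w'" "k \<le> rank (val w)"
  shows "T w = T w'"
proof (rule presentation_invariant[OF monoid_axioms pres, of T comb "\<lambda>x. k \<le> rank x"])
  fix x y assume "x \<in> carrier (sym_inv_monoid n)" "y \<in> carrier (sym_inv_monoid n)"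
    "k \<le> rank (x \<otimes>\<^bsub>sym_inv_monoid n\<^esub> y)"
  then show "k \<le> rank x \<and> k \<le> rank y" using rank_mult_le[of x n y] by linarith
qed (use assms in auto)

section \<open>Relations of rank n - 2\<close>

text \<open>The domain of the value of the longest prefix of rank at least \<open>n - 1\<close>.\<close>

fun prefix_dom :: "'a list \<Rightarrow> nat set" where
  "prefix_dom [] = {1..n}"
| "prefix_dom (a # w) =
    (if rank (g a) = n then {x. \<exists>y\<in>prefix_dom w. g a x = Some y}
     else if rank (g a) = n - 1 then dom (g a) else {1..n})"

lemma prefix_dom_subset: "z \<in> lists X \<Longrightarrow> prefix_dom z \<subseteq> {1..n}"
proof (induction z)
  case (Cons a z)
  then have "g a \<in> carrier (sym_inv_monoid n)" using g_closed by auto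
  then have "dom (g a) \<subseteq> {1..n}" by (rule sym_inv_monoid_carrierD)
  moreover have "{x. \<exists>y\<in>prefix_dom z. g a x = Some y} \<subseteq> dom (g a)" by (auto simp: dom_def)
  ultimately have "{x. \<exists>y\<in>prefix_dom z. g a x = Some y} \<subseteq> {1..n}" by (rule order_trans[rotated])
  then show ?case using \<open>dom (g a) \<subseteq> {1..n}\<close> by (simp only: prefix_dom.simps split: if_split) simp
qed simp

lemma pred_n_neq: "n - 1 \<noteq> n"
  using n by simp

text \<open>Provides the function \<open>comb\<close> for \<open>invariant\<close>. Once a prefix
  has rank n - 1, its domain stays the same as long as the rank does, so \<open>z\<close> matters
  only if \<open>w\<close> has full rank.\<close>

lemma prefix_dom_append:
  assumes "w \<in> lists X" "z \<in> lists X"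
  shows "prefix_dom (w @ z) =
    (if rank (val w) = n then {x. \<exists>y\<in>prefix_dom z. val w x = Some y}
     else if rank (val w) = n - 1 then dom (val w) else prefix_dom w)"
  using assms(1)
proof (induction w)
  case Nil
  have "prefix_dom z = {x. \<exists>y\<in>prefix_dom z. part_perm n {} id x = Some y}"
    using prefix_dom_subset[OF assms(2)] by (auto simp: part_perm_apply)
  then show ?case by (simp add: word_value_Nil one_eq_part_perm)
next
  case (Cons a w)
  define f where "f = g a"
  define h where "h = val w"
  let ?fh = "f \<otimes>\<^bsub>sym_inv_monoid n\<^esub> h"
  have f: "f \<in> carrier (sym_inv_monoid n)" and h: "h \<in> carrier (sym_inv_monoid n)"
    using Cons g_closed val_closed by (auto simp: f_def h_def)
  have IH: "prefix_dom (w @ z) =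
    (if rank h = n then {x. \<exists>y\<in>prefix_dom z. h x = Some y}
     else if rank h = n - 1 then dom h else prefix_dom w)"
    using Cons by (simp add: h_def)
  have val: "val (a # w) = ?fh" by (simp add: word_value_Cons f_def h_def)
  consider "rank f = n" | "rank f = n - 1" | "rank f < n - 1" using rank_le[OF f] by linarith
  then show ?case
  proof cases
    case 1
    have "rank ?fh = rank h" using rank_mult_full[OF f h 1] .
    moreover have "{x. \<exists>y\<in>{x. \<exists>y\<in>prefix_dom z. h x = Some y}. f x = Some y}
        = {x. \<exists>y\<in>prefix_dom z. ?fh x = Some y}"
      by (auto simp: sym_inv_monoid_mult_apply split: option.splits)
    moreover have "{x. \<exists>y\<in>dom h. f x = Some y} = dom ?fh"
      by (auto simp: sym_inv_monoid_mult_apply dom_def split: option.splits)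
    ultimately show ?thesis using 1 IH by (simp add: val flip: f_def)
  next
    case 2
    have "rank ?fh \<noteq> n" using rank_mult_le(1)[OF f h] 2 n by linarith
    moreover have "dom ?fh = dom f" if "rank ?fh = n - 1"
      using sym_inv_monoid_carrierD(4)[OF f] dom_mult_subset that 2
      by (intro card_subset_eq) (simp_all add: rank_def)
    ultimately show ?thesis using 2 pred_n_neq by (simp add: val flip: f_def)
  next
    case 3
    have "rank ?fh \<noteq> n" "rank ?fh \<noteq> n - 1" "rank f \<noteq> n" "rank f \<noteq> n - 1"
      using rank_mult_le(1)[OF f h] 3 by linarith+
    then show ?thesis by (simp add: val flip: f_def)
  qed
qed

lemma prefix_dom_eq_dom:
  assumes "w \<in> lists X" "n - 1 \<le> rank (val w)"
  shows "prefix_dom w = dom (val w)"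
proof -
  have w: "val w \<in> carrier (sym_inv_monoid n)" using assms(1) by (rule val_closed)
  have "{x. \<exists>y\<in>{1..n}. val w x = Some y} = dom (val w)"
    using sym_inv_monoid_carrierD(2)[OF w] ranI[of "val w"] by blast
  moreover have "rank (val w) = n \<or> rank (val w) = n - 1"
    using assms(2) rank_le[OF w] by linarith
  ultimately show ?thesis
    using prefix_dom_append[OF assms(1), of "[]"] pred_n_neq by auto
qed

lemma relation_of_rank_minus_2: "\<exists>q\<in>Q. rank (val (fst q)) = n - 2"
proof (rule ccontr)
  assume none: "\<not> ?thesis"
  have tr: "id permutes {1..n}" by (rule permutes_id)
  obtain u where u: "u \<in> lists X" "val u = part_perm n {1} id"
    using obtain_word[OF part_perm_in_carrier[OF tr]] .
  obtain v where v: "v \<in> lists X" "val v = part_perm n {2} id"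
    using obtain_word[OF part_perm_in_carrier[OF tr]] .
  have val: "val (u @ v) = part_perm n {1, 2} id" "val (v @ u) = part_perm n {1, 2} id"
    using u v by (simp_all add: val_append part_perm_mult[OF tr] insert_commute)
  have rank: "rank (val u) = n - 1" "rank (val v) = n - 1" "rank (val (u @ v)) = n - 2"
    using n unfolding val u(2) v(2) by (simp_all add: rank_part_perm)
  have "prefix_dom (u @ v) = prefix_dom (v @ u)"
  \<comment> \<open>By assumption no relation has rank n - 2, so those to be checked have rank at
    least n - 1, where \<open>prefix_dom\<close> is the domain of the common value.\<close>
  proof (rule invariant[where k = "n - 2"])
    fix a b assume "(a, b) \<in> Q" "n - 2 \<le> rank (val a)"
    moreover from this have "rank (val a) \<noteq> n - 2" using none by force
    ultimately show "prefix_dom a = prefix_dom b"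
      using relation[of a b] prefix_dom_eq_dom[of a] prefix_dom_eq_dom[of b] by simp
  qed (use prefix_dom_append u v val rank in auto)
  moreover have "prefix_dom (u @ v) = {1..n} - {1}" "prefix_dom (v @ u) = {1..n} - {2}"
    using prefix_dom_append[of u v] prefix_dom_append[of v u] u(1) v(1) rank(1,2) pred_n_neq
    by (simp_all add: u(2) v(2) dom_part_perm)
  moreover have "2 \<in> {1..n} - {1}" using n by simp
  ultimately show False by blast
qed

end

section \<open>Lower bound for the number of relations\<close>

context presented_sym_inv_monoid
begin

text \<open>The sign of the part to the left of the first singular letter. As signs commute,
  \<open>lsign (rev w)\<close> is the sign of the part to the right of the last one.\<close>

definition lsign :: "'a list \<Rightarrow> int" where
  "lsign w = prod_list (map (\<lambda>a. psign (g a)) (takeWhile (\<lambda>a. rank (g a) = n) w))"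

lemma takeWhile_singular_Nil: "singular w = [] \<Longrightarrow> takeWhile (\<lambda>a. rank (g a) = n) w = w"
  by (auto simp: singular_def filter_empty_conv)

lemma singular_Nil_rev: "singular (rev w) = [] \<longleftrightarrow> singular w = []"
  by (simp add: singular_def filter_empty_conv)

lemma psign_val:
  assumes "w \<in> lists X" "singular w = []"
  shows "psign (val w) = prod_list (map (\<lambda>a. psign (g a)) w)"
  using assms
proof (induction w)
  case Nil
  show ?case
    using psign_perm[OF permutes_id, of n] by (simp only: word_value_Nil one_eq_part_perm sign_id) simp
next
  case (Cons a w)
  then have "singular w = []" "rank (g a) = n" by (auto simp: singular_def split: if_splits)
  moreover from this have "rank (val w) = n" using Cons singular_Nil_iff[of w] by simp
  moreover have "g a \<in> carrier (sym_inv_monoid n)" "val w \<in> carrier (sym_inv_monoid n)"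
    using Cons g_closed val_closed by auto
  ultimately show ?case using Cons by (simp add: word_value_Cons psign_mult)
qed

lemma lsign_singular_Nil:
  assumes "w \<in> lists X" "singular w = []"
  shows "lsign w = psign (val w)" "lsign (rev w) = psign (val w)"
proof -
  show "lsign w = psign (val w)"
    unfolding lsign_def takeWhile_singular_Nil[OF assms(2)] psign_val[OF assms] ..
  have "takeWhile (\<lambda>a. rank (g a) = n) (rev w) = rev w"
    using assms(2) by (intro takeWhile_singular_Nil) (simp add: singular_Nil_rev)
  then show "lsign (rev w) = psign (val w)"
    by (simp only: lsign_def psign_val[OF assms] rev_map[symmetric] prod_list.rev)
qed

lemma lsign_append:
  "lsign (w @ z) = (if singular w = [] then lsign w * lsign z else lsign w)"
proof (cases "singular w = []")
  case True
  then have "\<forall>a\<in>set w. rank (g a) = n" by (auto simp: singular_def filter_empty_conv)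
  then have "takeWhile (\<lambda>a. rank (g a) = n) (w @ z) = w @ takeWhile (\<lambda>a. rank (g a) = n) z"
    by (intro takeWhile_append2) blast
  then show ?thesis
    using True by (simp only: lsign_def takeWhile_singular_Nil[OF True] map_append prod_list.append simp_thms if_True)
next
  case False
  then obtain a where "a \<in> set w" "rank (g a) \<noteq> n" by (auto simp: singular_def filter_empty_conv)
  then show ?thesis using False by (simp add: lsign_def takeWhile_append1)
qed

text \<open>
  Sending the letters of rank \<open>n\<close> to their signs and every other letter to \<open>i \<mapsto> s i + 1\<close> defines a
  homomorphism to the affine maps of \<open>\<int>\<close>; \<open>aff_sign\<close> and \<open>aff_shift\<close> are the linear and the
  constant part. Modulo 3 its image lies in a copy of \<open>S\<^sub>3\<close>.
\<close>

fun aff_sign :: "int \<Rightarrow> 'a list \<Rightarrow> int" where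
  "aff_sign s [] = 1"
| "aff_sign s (a # w) = (if rank (g a) = n then psign (g a) else s) * aff_sign s w"

fun aff_shift :: "int \<Rightarrow> 'a list \<Rightarrow> int" where
  "aff_shift s [] = 0"
| "aff_shift s (a # w) = (if rank (g a) = n then psign (g a) * aff_shift s w else 1 + s * aff_shift s w)"

lemma aff_append:
  "aff_sign s (w @ z) = aff_sign s w * aff_sign s z"
  "aff_shift s (w @ z) = aff_shift s w + aff_sign s w * aff_shift s z"
  by (induction w) (simp_all add: algebra_simps)

lemma aff_singular_Nil:
  assumes "w \<in> lists X" "singular w = []"
  shows "aff_sign s w = psign (val w)" "aff_shift s w = 0"
proof -
  have "aff_sign s w = prod_list (map (\<lambda>a. psign (g a)) w) \<and> aff_shift s w = 0"
    using assms(2) by (induction w) (auto simp: singular_def split: if_splits)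
  then show "aff_sign s w = psign (val w)" "aff_shift s w = 0"
    using psign_val[OF assms] by simp_all
qed

section \<open>Letters of rank n - 1\<close>

lemma singular_letter_rank:
  assumes "w \<in> lists X" "rank (val w) = n - 1" "a \<in> set (singular w)"
  shows "rank (g a) = n - 1" "a \<in> X"
proof -
  have a: "a \<in> set w" "rank (g a) \<noteq> n" using assms(3) by (auto simp: singular_def)
  then show "a \<in> X" using assms(1) by auto
  then have "rank (g a) \<le> n" using g_closed by (intro rank_le) auto
  then show "rank (g a) = n - 1" using rank_letter[OF assms(1) a(1)] a(2) assms(2) by linarith
qed

lemma ex_singular_letter: "\<exists>b\<in>X. rank (g b) = n - 1"
proof -
  obtain w where w: "w \<in> lists X" "val w = part_perm n {1} id"
    using obtain_word[OF part_perm_in_carrier[OF permutes_id]] .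
  then have "rank (val w) = n - 1" using n by (simp add: rank_part_perm)
  moreover from this have "singular w \<noteq> []" using singular_Nil_iff[OF w(1)] pred_n_neq by simp
  then obtain a where "a \<in> set (singular w)" by (meson list.set_sel(1))
  ultimately show ?thesis using singular_letter_rank w(1) by blast
qed

lemma corank_one:
  assumes "b \<in> X" "rank (g b) = n - 1"
  obtains i p where "i \<in> {1..n}" "p permutes {1..n}" "g b = part_perm n {i} p"
proof -
  have gb: "g b \<in> carrier (sym_inv_monoid n)" using assms(1) g_closed by auto
  then obtain p where p: "p permutes {1..n}" "g b = part_perm n ({1..n} - dom (g b)) p"
    by (rule sym_inv_monoid_part_perm)
  have "card ({1..n} - dom (g b)) = 1"
    using sym_inv_monoid_carrierD(1,4)[OF gb] assms(2) n
    by (simp add: card_Diff_subset rank_def)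
  then obtain i where i: "{1..n} - dom (g b) = {i}" by (auto simp: card_1_singleton_iff One_nat_def)
  then have "i \<in> {1..n}" by blast
  then show ?thesis using that p i by simp
qed

lemma obtain_perm_word:
  assumes "p permutes {1..n}"
  obtains w where "w \<in> lists X" "val w = part_perm n {} p" "singular w = []" "psign (val w) = sign p"
proof -
  obtain w where "w \<in> lists X" "val w = part_perm n {} p"
    using obtain_word[OF part_perm_in_carrier[OF assms]] .
  then show ?thesis using that singular_Nil_iff[of w] psign_perm[OF assms] by simp
qed

text \<open>With \<open>z\<close> inverting the permutation part of \<open>b\<close>, the word
  \<open>b # z\<close> represents an idempotent. Words with one and with two singular letters thus
  share a value.\<close>

lemma idempotent_witness:
  assumes b: "b \<in> X" "rank (g b) = n - 1"
  obtains z where "z \<in> lists X" "singular z = []" "val (b # z @ b # z) = val (b # z)"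
    "rank (val (b # z)) = n - 1"
proof -
  obtain i p where ip: "i \<in> {1..n}" "p permutes {1..n}" "g b = part_perm n {i} p"
    using corank_one[OF b] .
  obtain z where z: "z \<in> lists X" "val z = part_perm n {} (inv_into UNIV p)" "singular z = []"
    using obtain_perm_word[OF permutes_inv[OF ip(2)]] .
  have bz: "val (b # z) = part_perm n {i} id"
    unfolding word_value_Cons ip(3) z(2) part_perm_mult[OF ip(2)] permutes_inv_o(2)[OF ip(2)]
    by simp
  have "val ((b # z) @ (b # z)) = val (b # z) \<otimes>\<^bsub>sym_inv_monoid n\<^esub> val (b # z)"
    using z(1) b(1) by (intro val_append) auto
  also have "\<dots> = val (b # z)"
    unfolding bz part_perm_mult[OF permutes_id] by simp
  finally show ?thesis
    using that z ip(1) by (simp add: bz rank_part_perm)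
qed

text \<open>The domain of \<open>g b\<close> contains two points because n is at least 3, and their
  transposition passes through \<open>b\<close> as the transposition of their images. So the value
  fixes neither the sign to the left of \<open>b\<close> nor the sign to its right.\<close>

lemma swap_witness:
  assumes b: "b \<in> X" "rank (g b) = n - 1"
  obtains t t' where "t \<in> lists X" "t' \<in> lists X" "singular t = []" "singular t' = []"
    "psign (val t) = -1" "psign (val t') = -1" "val (t @ [b]) = val (b # t')"
    "rank (val (b # t')) = n - 1"
proof -
  obtain i p where ip: "i \<in> {1..n}" "p permutes {1..n}" "g b = part_perm n {i} p"
    using corank_one[OF b] .
  have "2 \<le> card ({1..n} - {i})" using n ip(1) by simp
  then obtain T where T: "T \<subseteq> {1..n} - {i}" "card T = 2"
    by (meson obtain_subset_with_card_n)
  then obtain j k where jk: "T = {j, k}" "j \<noteq> k" by (meson card_2_iff)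
  then have jk': "j \<in> {1..n}" "k \<in> {1..n}" "j \<noteq> i" "k \<noteq> i" using T by auto
  have pj: "p j \<in> {1..n}" "p k \<in> {1..n}" "p j \<noteq> p k"
    using jk(2) jk' permutes_in_image[OF ip(2)] permutes_inj[OF ip(2)] by (auto dest: injD)
  obtain t where t: "t \<in> lists X" "val t = part_perm n {} (transpose j k)" "singular t = []"
    "psign (val t) = sign (transpose j k)"
    using obtain_perm_word[OF permutes_swap_id[OF jk'(1,2)]] .
  obtain t' where t': "t' \<in> lists X" "val t' = part_perm n {} (transpose (p j) (p k))"
    "singular t' = []" "psign (val t') = sign (transpose (p j) (p k))"
    using obtain_perm_word[OF permutes_swap_id[OF pj(1,2)]] .
  have "transpose j k -` {i} = {i}" using jk' by (auto simp: transpose_def split: if_splits)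
  then have "val (t @ [b]) = part_perm n {i} (p \<circ> transpose j k)"
    using t b(1) ip(3)
    by (simp add: val_append val_singleton part_perm_mult[OF permutes_swap_id[OF jk'(1,2)]])
  moreover have "val (b # t') = part_perm n {i} (transpose (p j) (p k) \<circ> p)"
    by (simp add: word_value_Cons t'(2) ip(3) part_perm_mult[OF ip(2)])
  ultimately show ?thesis
    using that t t' pj(3) jk(2) ip(1) comp_transpose[OF permutes_inj[OF ip(2)], of j k]
    by (simp add: sign_swap_id rank_part_perm)
qed

section \<open>Relations of rank n - 1\<close>

lemma singular_length_1:
  assumes "singular w = [b]" "w \<in> lists X"
  obtains x y where "w = x @ [b] @ y" "singular x = []" "singular y = []" "x \<in> lists X" "y \<in> lists X"
    "rank (g b) \<noteq> n"
proof -
  obtain x y where xy: "w = x @ b # y" "\<forall>a\<in>set x. \<not> rank (g a) \<noteq> n" "rank (g b) \<noteq> n" "[] = singular y"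
    using assms(1) unfolding singular_def filter_eq_Cons_iff by blast
  then show ?thesis using that assms(2) by (auto simp: singular_def)
qed

lemma singular_length_2:
  assumes "singular w = [b, c]" "w \<in> lists X"
  obtains x m y where "w = x @ [b] @ m @ [c] @ y" "singular x = []" "singular m = []" "singular y = []"
    "x \<in> lists X" "m \<in> lists X" "y \<in> lists X"
proof -
  obtain x z where xz: "w = x @ b # z" "\<forall>a\<in>set x. \<not> rank (g a) \<noteq> n" "[c] = singular z"
    using assms(1) unfolding singular_def filter_eq_Cons_iff by blast
  have z: "singular z = [c]" "z \<in> lists X" using xz assms(2) by simp_all
  obtain m y where my: "z = m @ [c] @ y" "singular m = []" "singular y = []"
    "m \<in> lists X" "y \<in> lists X" "rank (g c) \<noteq> n"
    using singular_length_1[OF z] .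
  have "singular x = []" "x \<in> lists X"
    using xz(1,2) assms(2) by (simp_all add: singular_def filter_empty_conv)
  with xz(1) my show ?thesis by (intro that[of x m y]) simp_all
qed

lemma invariant_rank_minus_1:
  assumes single: "\<forall>(u', v')\<in>Q. rank (val u') = n - 1 \<longrightarrow> (u', v') = (u, v) \<or> (v', u') = (u, v)"
    and T: "T u = T v"
    and comb: "\<And>w z. w \<in> lists X \<Longrightarrow> z \<in> lists X \<Longrightarrow> T (w @ z) = comb (val w) (T w) (val z) (T z)"
    and full: "\<And>w w'. w \<in> lists X \<Longrightarrow> w' \<in> lists X \<Longrightarrow> singular w = [] \<Longrightarrow> singular w' = [] \<Longrightarrow>
        val w = val w' \<Longrightarrow> T w = T w'"
    and w: "w \<in> lists X" "w' \<in> lists X" "val w = val w'" "rank (val w) = n - 1"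
  shows "T w = T w'"
proof (rule invariant[where k = "n - 1" and comb = comb])
  fix u' v' assume Q: "(u', v') \<in> Q" and "n - 1 \<le> rank (val u')"
  then consider "rank (val u') = n" | "rank (val u') = n - 1"
    using relation[OF Q] rank_le[OF val_closed, of u'] by linarith
  then show "T u' = T v'"
  proof cases
    case 1
    then show ?thesis
      using relation[OF Q] singular_Nil_iff[of u'] singular_Nil_iff[of v'] by (intro full) auto
  next
    case 2
    then show ?thesis using single Q T by auto
  qed
qed (use comb w in auto)

lemma not_single_relation:
  assumes uv: "u \<in> lists X" "v \<in> lists X" "val u = val v" "rank (val u) = n - 1"
    and single: "\<forall>(u', v')\<in>Q. rank (val u') = n - 1 \<longrightarrow> (u', v') = (u, v) \<or> (v', u') = (u, v)"
    and len: "length (singular u) \<le> length (singular v)"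
  shows False
proof -
  note inv = invariant_rank_minus_1[OF single]
  define d where "d = length (singular v) - length (singular u)"
  obtain b where b: "b \<in> X" "rank (g b) = n - 1" using ex_singular_letter by blast
  have d: "d = 1"
  proof -
    obtain z where z: "z \<in> lists X" "singular z = []" "val (b # z @ b # z) = val (b # z)"
      "rank (val (b # z)) = n - 1"
      using idempotent_witness[OF b] .
    have "length (singular (b # z @ b # z)) mod d = length (singular (b # z)) mod d"
    proof (rule inv[where T = "\<lambda>w. length (singular w) mod d"
          and comb = "\<lambda>_ x _ y. (x + y) mod d"])
      show "length (singular u) mod d = length (singular v) mod d"
      proof -
        have "length (singular v) = length (singular u) + d" using len by (simp add: d_def)
        then show ?thesis by simp
      qed
    qed (use z b in \<open>auto simp: singular_append mod_add_eq\<close>)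
    moreover have "singular [b] = [b]" using b(2) pred_n_neq by (simp add: singular_def)
    then have "length (singular (b # z)) = 1" "length (singular (b # z @ b # z)) = 2"
      using singular_append[of "[b]"] singular_append[of z] z(2) by simp_all
    \<comment> \<open>As \<open>x mod 0 = x\<close>, this also rules out
      \<open>d = 0\<close>.\<close>
    ultimately have "2 mod d = 1 mod d" by simp
    then show "d = 1"
      by (cases "d = 0"; cases "d = 2"; cases "d > 2") auto
  qed
  have singular_u_v: "singular u = [b'] \<or> singular v = [b']" if b': "b' \<in> X" "rank (g b') = n - 1" for b'
  proof (rule ccontr)
    assume neq: "\<not> ?thesis"
    \<comment> \<open>If neither side had \<open>b'\<close> as its only singular letter,
      \<open>T\<close> would vanish on both and be an invariant, although it separates the two words
      of \<open>swap_witness\<close>.\<close>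
    define T where "T w = (if singular w = [b'] then lsign w else 0)" for w
    obtain t t' where t: "t \<in> lists X" "t' \<in> lists X" "singular t = []" "singular t' = []"
      "psign (val t) = -1" "psign (val t') = -1" "val (t @ [b']) = val (b' # t')"
      "rank (val (b' # t')) = n - 1"
      using swap_witness[OF b'] .
    have sb: "singular [b'] = [b']" using b'(2) pred_n_neq by (simp add: singular_def)
    have "T (t @ [b']) = T (b' # t')"
    proof (rule inv[where T = T and
          comb = "\<lambda>x i y j. if rank x = n then psign x * j else if rank y = n then i else 0"])
      fix w z assume wz: "w \<in> lists X" "z \<in> lists X"
      have *: "singular w @ singular z \<noteq> [b']" if "singular w \<noteq> []" "singular z \<noteq> []"
        using that by (cases "singular w"; cases "singular z") auto
      show "T (w @ z) = (if rank (val w) = n then psign (val w) * T z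
          else if rank (val z) = n then T w else 0)"
        using wz * lsign_singular_Nil(1)[of w] singular_Nil_iff[of w] singular_Nil_iff[of z]
        by (auto simp: T_def singular_append lsign_append)
    qed (use neq t b' in \<open>auto simp: T_def\<close>)
    moreover have "T (t @ [b']) = -1"
      using t sb lsign_singular_Nil(1)[of t]
      by (simp add: T_def singular_append lsign_append) (simp add: lsign_def b'(2) pred_n_neq)
    moreover have "T ([b'] @ t') = 1"
      using t sb by (simp only: T_def singular_append lsign_append) (simp add: lsign_def b'(2) pred_n_neq)
    ultimately show False by simp
  qed
  have "singular u \<noteq> []" using singular_Nil_iff[OF uv(1)] uv(4) pred_n_neq by simp
  then have "2 \<le> length (singular v)" using d len unfolding d_def by (cases "singular u") auto
  then have v_neq: "singular v \<noteq> [b']" for b' by auto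
  have u_b: "singular u = [b]" using singular_u_v[OF b] v_neq by blast
  then have "length (singular v) = 2" using d len by (simp add: d_def)
  then obtain b1 b2 where b12: "singular v = [b1, b2]"
    by (metis (no_types, opaque_lifting) length_0_conv length_Suc_conv numeral_2_eq_2)
  \<comment> \<open>Since \<open>v\<close> has two singular letters, each letter of rank n - 1 must
    be the only singular letter of \<open>u\<close>.\<close>
  have "b' = b" if "b' \<in> set (singular v)" for b'
    using singular_u_v[of b'] singular_letter_rank[OF uv(2) _ that] uv(3,4) v_neq[of b'] u_b by simp
  then have v_b: "singular v = [b, b]" using b12 by simp

  obtain t t' where t: "t \<in> lists X" "t' \<in> lists X" "singular t = []" "singular t' = []"
    "psign (val t) = -1" "psign (val t') = -1" "val (t @ [b]) = val ([b] @ t')"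
    "rank (val ([b] @ t')) = n - 1"
    using swap_witness[OF b] by auto
  have t_rank: "rank (val (t @ [b])) = n - 1" using t by simp
  have bX: "[b] \<in> lists X" using b by simp
  have tb: "t @ [b] \<in> lists X" "[b] @ t' \<in> lists X" using t bX by simp_all
  have sb: "singular [b] = [b]" "lsign [b] = 1"
    using b(2) pred_n_neq by (simp_all add: singular_def lsign_def)
  have lsign_neq: "lsign u \<noteq> lsign v"
  proof
    assume "lsign u = lsign v"
    then have "lsign (t @ [b]) = lsign ([b] @ t')"
    proof (rule inv[where T = lsign and
          comb = "\<lambda>x i y j. if rank x = n then psign x * j else i"])
      fix w z assume "w \<in> lists X" "z \<in> lists X"
      then show "lsign (w @ z) = (if rank (val w) = n then psign (val w) * lsign z else lsign w)"
        using lsign_singular_Nil(1)[of w] singular_Nil_iff[of w] by (simp add: lsign_append)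
    next
      fix w w' assume "w \<in> lists X" "w' \<in> lists X" "singular w = []" "singular w' = []" "val w = val w'"
      then show "lsign w = lsign w'" by (simp add: lsign_singular_Nil)
    qed (use tb t t_rank in auto)
    then show False
      using t sb by (simp add: lsign_append lsign_singular_Nil del: append_Cons)
  qed
  have rsign_neq: "lsign (rev u) \<noteq> lsign (rev v)"
  proof
    assume "lsign (rev u) = lsign (rev v)"
    then have "lsign (rev (t @ [b])) = lsign (rev ([b] @ t'))"
    proof (rule inv[where comb = "\<lambda>x i y j. if rank y = n then psign y * i else j" and
          T = "\<lambda>w. lsign (rev w)"])
      fix w z assume "w \<in> lists X" "z \<in> lists X"
      then show "lsign (rev (w @ z))
          = (if rank (val z) = n then psign (val z) * lsign (rev w) else lsign (rev z))"
        using lsign_singular_Nil(2)[of z] singular_Nil_iff[of z]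
        by (simp add: lsign_append singular_Nil_rev)
    next
      fix w w' assume "w \<in> lists X" "w' \<in> lists X" "singular w = []" "singular w' = []" "val w = val w'"
      then show "lsign (rev w) = lsign (rev w')" by (simp add: lsign_singular_Nil)
    qed (use tb t t_rank in auto)
    then show False
      using t sb by (simp add: lsign_append lsign_singular_Nil singular_Nil_rev del: append_Cons)
  qed

  obtain x y where u: "u = x @ [b] @ y" "singular x = []" "singular y = []"
    "x \<in> lists X" "y \<in> lists X"
    using singular_length_1[OF u_b uv(1)] .
  obtain x' m y' where v: "v = x' @ [b] @ m @ [b] @ y'" "singular x' = []" "singular m = []"
    "singular y' = []" "x' \<in> lists X" "m \<in> lists X" "y' \<in> lists X"
    using singular_length_2[OF v_b uv(2)] .
  \<comment> \<open>With the sign of \<open>m\<close> as linear part of \<open>b\<close>, the map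
    for \<open>v\<close> has constant part \<open>- p * (1 + s * s) = - 2 * p\<close>, congruent to
    \<open>p\<close> modulo 3. The linear parts agree because both outer signs are reversed.\<close>
  define s where "s = psign (val m)"
  define p where "p = psign (val x)"
  define q where "q = psign (val y)"
  have "lsign u = p" "lsign v = psign (val x')"
    using u v sb by (simp_all add: lsign_append lsign_singular_Nil p_def del: append_Cons)
  then have x': "psign (val x') = - p"
    using lsign_neq psign_cases[of "val x"] psign_cases[of "val x'"] by (auto simp: p_def)
  have "lsign (rev u) = q" "lsign (rev v) = psign (val y')"
    using u v sb
    by (simp_all add: lsign_append lsign_singular_Nil singular_Nil_rev q_def del: append_Cons)
  then have y': "psign (val y') = - q"
    using rsign_neq psign_cases[of "val y"] psign_cases[of "val y'"] by (auto simp: q_def)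
  have s: "s * s = 1" using psign_cases[of "val m"] by (auto simp: s_def)
  have aff_b: "aff_sign s [b] = s" "aff_shift s [b] = 1" using b(2) pred_n_neq by simp_all
  have aff_u: "aff_sign s u = p * s * q" "aff_shift s u = p"
    using u by (simp_all add: aff_append aff_singular_Nil aff_b p_def q_def
        del: append_Cons aff_sign.simps aff_shift.simps)
  have aff_v: "aff_sign s v = p * s * q" "aff_shift s v = - 2 * p"
    using v s x' y' by (simp_all add: aff_append aff_singular_Nil aff_b flip: s_def
        del: append_Cons aff_sign.simps aff_shift.simps)
  have mod_eq: "(i + j * k) mod 3 = (i mod 3 + j * (k mod 3)) mod 3" for i j k :: int
    by (intro mod_add_cong mod_mult_cong) simp_all
  have "(aff_sign s (t @ [b]), aff_shift s (t @ [b]) mod 3)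
      = (aff_sign s ([b] @ t'), aff_shift s ([b] @ t') mod 3)"
  proof (rule inv[where T = "\<lambda>w. (aff_sign s w, aff_shift s w mod 3)"
        and comb = "\<lambda>_ x _ y. (fst x * fst y, (snd x + fst x * snd y) mod 3)"])
    have "p mod 3 = (- 2 * p) mod 3" using psign_cases[of "val x"] by (auto simp: p_def)
    then show "(aff_sign s u, aff_shift s u mod 3) = (aff_sign s v, aff_shift s v mod 3)"
      by (simp only: aff_u aff_v)
  next
    fix w w' assume "w \<in> lists X" "w' \<in> lists X" "singular w = []" "singular w' = []" "val w = val w'"
    then show "(aff_sign s w, aff_shift s w mod 3) = (aff_sign s w', aff_shift s w' mod 3)"
      by (simp add: aff_singular_Nil)
  next
    fix w z :: "'a list"
    show "(aff_sign s (w @ z), aff_shift s (w @ z) mod 3)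
      = (fst (aff_sign s w, aff_shift s w mod 3) * fst (aff_sign s z, aff_shift s z mod 3),
          (snd (aff_sign s w, aff_shift s w mod 3)
            + fst (aff_sign s w, aff_shift s w mod 3) * snd (aff_sign s z, aff_shift s z mod 3)) mod 3)"
      using mod_eq by (simp only: aff_append fst_conv snd_conv)
  qed (use tb t t_rank in auto)
  \<comment> \<open>The constant parts are -1 for \<open>t @ [b]\<close> and 1 for
    \<open>[b] @ t'\<close>, which differ modulo 3.\<close>
  then show False
    using t by (simp add: aff_append aff_singular_Nil aff_b
        del: append_Cons aff_sign.simps aff_shift.simps)
qed

lemma relations_of_rank_minus_1:
  "\<exists>q1\<in>Q. \<exists>q2\<in>Q. q1 \<noteq> q2 \<and> rank (val (fst q1)) = n - 1 \<and> rank (val (fst q2)) = n - 1"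
proof (rule ccontr)
  assume none: "\<not> ?thesis"
  obtain u v where uv: "u \<in> lists X" "v \<in> lists X" "val u = val v" "rank (val u) = n - 1"
    and single: "\<forall>(u', v')\<in>Q. rank (val u') = n - 1 \<longrightarrow> (u', v') = (u, v)"
  proof (cases "\<exists>(u, v)\<in>Q. rank (val u) = n - 1")
    case True
    then obtain u v where uv: "(u, v) \<in> Q" "rank (val u) = n - 1" by blast
    moreover have "\<forall>(u', v')\<in>Q. rank (val u') = n - 1 \<longrightarrow> (u', v') = (u, v)"
      using none uv by force
    ultimately show ?thesis using that[of u v] relation[OF uv(1)] by blast
  next
    case False
    obtain b where "b \<in> X" "rank (g b) = n - 1" using ex_singular_letter by blast
    \<comment> \<open>Without any relation of rank n - 1, the trivial relation b = b takes the place
      of the single one.\<close>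
    moreover have "\<forall>(u', v')\<in>Q. rank (val u') = n - 1 \<longrightarrow> (u', v') = ([b], [b])"
      using False by blast
    ultimately show ?thesis using that[of "[b]" "[b]"] by (simp add: val_singleton)
  qed
  show False
  \<comment> \<open>The sides are ordered so that the second has at least as many singular
    letters.\<close>
  proof (cases "length (singular u) \<le> length (singular v)")
    case True
    then show ?thesis using not_single_relation[OF uv] single by blast
  next
    case False
    then show ?thesis using not_single_relation[of v u] uv single by auto
  qed
qed

end

theorem theorem1p4:
  shows
    "(\<forall>(n::nat) (A :: 'a set) (R :: ('a list \<times> 'a list) set) (g :: 'a \<Rightarrow> (nat \<rightharpoonup> nat))
        (\<eta> :: 'a) (t :: 'a list) (c :: 'a list) (s :: 'a list).
        n \<ge> 4 \<longrightarrow>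
        monoid_presentation A R (sym_submonoid n) g \<longrightarrow>
        \<eta> \<notin> A \<longrightarrow>
        t \<in> lists A \<longrightarrow> word_value (sym_submonoid n) g t = cycle_map n [2, 3] \<longrightarrow>
        c \<in> lists A \<longrightarrow> word_value (sym_submonoid n) g c = cycle_map n [2..<Suc n] \<longrightarrow>
        s \<in> lists A \<longrightarrow> word_value (sym_submonoid n) g s = cycle_map n [1, 2] \<longrightarrow>
        monoid_presentation (A \<union> {\<eta>})
          (R \<union> {(t @ [\<eta>], [\<eta>] @ t),
                (c @ [\<eta>], [\<eta>, \<eta>] @ c),
                (s @ [\<eta>] @ s @ [\<eta>] @ s @ [\<eta>] @ s, [\<eta>] @ s @ [\<eta>])})
          (sym_inv_monoid n)
          (g(\<eta> := Some |` {2..n})))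
     \<and>
     (\<forall>(n::nat) (A :: 'b set) (B :: 'b set) (R :: ('b list \<times> 'b list) set)
        (S :: ('b list \<times> 'b list) set) (g :: 'b \<Rightarrow> (nat \<rightharpoonup> nat)).
        n \<ge> 3 \<longrightarrow>
        A \<inter> B = {} \<longrightarrow>
        R \<subseteq> lists A \<times> lists A \<longrightarrow>
        monoid_presentation (A \<union> B) (R \<union> S) (sym_inv_monoid n) g \<longrightarrow>
        monoid_presentation A R (sym_submonoid n) g \<longrightarrow>
        card S \<ge> 3)"
proof (intro conjI allI impI)
  fix n :: nat and A :: "'a set" and R g \<eta> t c s
  assume "n \<ge> 4" "monoid_presentation A R (sym_submonoid n) g" "\<eta> \<notin> A"
    "t \<in> lists A" "word_value (sym_submonoid n) g t = cycle_map n [2, 3]"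
    "c \<in> lists A" "word_value (sym_submonoid n) g c = cycle_map n [2..<Suc n]"
    "s \<in> lists A" "word_value (sym_submonoid n) g s = cycle_map n [1, 2]"
  then show "monoid_presentation (A \<union> {\<eta>})
          (R \<union> {(t @ [\<eta>], [\<eta>] @ t),
                (c @ [\<eta>], [\<eta>, \<eta>] @ c),
                (s @ [\<eta>] @ s @ [\<eta>] @ s @ [\<eta>] @ s, [\<eta>] @ s @ [\<eta>])})
          (sym_inv_monoid n)
          (g(\<eta> := Some |` {2..n}))"
    by (intro presentation_of_sym_inv_monoid) simp_all
next
  fix n :: nat and A B :: "'b set" and R S g
  assume n: "n \<ge> 3" and R: "R \<subseteq> lists A \<times> lists A"
    and pres: "monoid_presentation (A \<union> B) (R \<union> S) (sym_inv_monoid n) g"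
    and presA: "monoid_presentation A R (sym_submonoid n) g"
  interpret presented_sym_inv_monoid n "A \<union> B" "R \<union> S" g
    using n pres by unfold_locales
  have rank_R: "rank (val u) = n" if "(u, v) \<in> R" for u v
  proof -
    have u: "u \<in> lists A" using R that by blast
    have "word_value (sym_submonoid n) g u \<in> carrier (sym_submonoid n)"
      using presA u by (auto simp: monoid_presentation_def)
    then show ?thesis
      by (auto simp: word_value_sym_submonoid sym_submonoid_simps perm_map_eq_part_perm)
  qed
  obtain q1 q2 where q12: "q1 \<in> R \<union> S" "q2 \<in> R \<union> S" "q1 \<noteq> q2"
    "rank (val (fst q1)) = n - 1" "rank (val (fst q2)) = n - 1"
    using relations_of_rank_minus_1 by blast
  obtain q3 where q3: "q3 \<in> R \<union> S" "rank (val (fst q3)) = n - 2"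
    using relation_of_rank_minus_2 by auto
  \<comment> \<open>Relations in \<open>R\<close> have rank \<open>n\<close>, so the three relations
    of smaller rank lie in \<open>S\<close>; the rank also separates \<open>q3\<close> from the
    other two.\<close>
  have "{q1, q2, q3} \<subseteq> S"
    using q12 q3 rank_R[of "fst q1" "snd q1"] rank_R[of "fst q2" "snd q2"]
      rank_R[of "fst q3" "snd q3"] n by auto
  moreover have "finite S" using pres by (simp add: monoid_presentation_def)
  ultimately have "card {q1, q2, q3} \<le> card S" by (intro card_mono)
  moreover have "q3 \<noteq> q1" "q3 \<noteq> q2" using q12 q3 n by auto
  ultimately show "card S \<ge> 3" using q12(3) by simp
qed

end
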